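(* Let $F$ be a ribbon graph, let $\alpha\neq -2,0,1$, $\beta=\alpha(1-\alpha)$ and $\gamma=1/\sqrt{\alpha\beta}$. Then \[ R(F\otimes C_3;\alpha,\beta,\gamma)=(\alpha+2)^{n(F)}\,R\!\left(F;\,\alpha(\alpha+2),\,\frac{\beta}{\alpha+2},\,\gamma\right). \]
   Context: A ribbon graph is a graph with a fixed cyclic order of half-edges at each vertex, regarded as an orientable surface with boundary (vertex discs joined by untwisted edge bands). $v,e,k$ denote numbers of vertices, edges, connected components; $r(H)=v(H)-k(H)$, $n(H)=e(H)-r(H)$; $p(H)$ is the number of boundary components of $H$ as a surface. A state is a spanning sub-ribbon graph (all vertices, a subset of edges); ${\mathcal S}(F)$ is the set of states. Bollobás–Riordan polynomial: $R(F;\alpha,\beta,\gamma)=\sum_{H\in{\mathcal S}(F)}\alpha^{r(F)-r(H)}\beta^{n(H)}\gamma^{k(H)-p(H)+n(H)}$. Tensor product with a cycle: $F\otimes C_p$ is obtained by identifying each edge of $F$ with a distinguished edge of its own copy of the $p$-cycle $C_p$ and then deleting the original edges (a 2-sum with $C_p$ at every edge); equivalently each edge of $F$ is replaced, within its band, by a path of $p-1$ edges through $p-2$ new degree-two vertices. In particular $F\otimes C_3$ is obtained by subdividing every edge of $F$ once. *)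

theory Defs
  imports Complex_Main "HOL-Combinatorics.Orbits"
begin

text \<open>
  Ribbon graphs are encoded by their half-edges (darts): \<open>vert d\<close> is the vertex carrying the
  half-edge \<open>d\<close>, \<open>opp d\<close> is the other half of the edge of \<open>d\<close>, and \<open>rot d\<close> is the successor of
  \<open>d\<close> in the cyclic order at \<open>vert d\<close>. The vertex set is kept separately, since vertices without
  half-edges must be allowed. Loops and multiple edges are allowed.
\<close>

record ('v, 'd) pre_ribbon_graph =
  verts :: "'v set"
  darts :: "'d set"
  vert :: "'d \<Rightarrow> 'v"
  opp :: "'d \<Rightarrow> 'd"
  rot :: "'d \<Rightarrow> 'd"

definition darts_at :: "('v, 'd) pre_ribbon_graph \<Rightarrow> 'v \<Rightarrow> 'd set" where
  "darts_at F v = {d \<in> darts F. vert F d = v}"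

locale ribbon_graph =
  fixes F :: "('v, 'd) pre_ribbon_graph"
  assumes finite_verts: "finite (verts F)"
    and finite_darts: "finite (darts F)"
    and vert_in_verts: "d \<in> darts F \<Longrightarrow> vert F d \<in> verts F"
    and opp_in_darts: "d \<in> darts F \<Longrightarrow> opp F d \<in> darts F"
    and opp_neq: "d \<in> darts F \<Longrightarrow> opp F d \<noteq> d"
    and opp_opp: "d \<in> darts F \<Longrightarrow> opp F (opp F d) = d"
    and rot_cyclic: "v \<in> verts F \<Longrightarrow> darts_at F v \<noteq> {} \<Longrightarrow> cyclic_on (rot F) (darts_at F v)"

definition edges :: "('v, 'd) pre_ribbon_graph \<Rightarrow> 'd set set" where
  "edges F = (\<lambda>d. {d, opp F d}) ` darts F"

definition adjacency :: "('v, 'd) pre_ribbon_graph \<Rightarrow> 'v rel" where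
  "adjacency F = (\<lambda>d. (vert F d, vert F (opp F d))) ` darts F"

definition components :: "('v, 'd) pre_ribbon_graph \<Rightarrow> 'v set set" where
  "components F = verts F // (adjacency F)\<^sup>*"

definition num_v :: "('v, 'd) pre_ribbon_graph \<Rightarrow> int" where
  "num_v F = int (card (verts F))"

definition num_e :: "('v, 'd) pre_ribbon_graph \<Rightarrow> int" where
  "num_e F = int (card (edges F))"

definition num_k :: "('v, 'd) pre_ribbon_graph \<Rightarrow> int" where
  "num_k F = int (card (components F))"

definition rk :: "('v, 'd) pre_ribbon_graph \<Rightarrow> int" where
  "rk F = num_v F - num_k F"

definition nul :: "('v, 'd) pre_ribbon_graph \<Rightarrow> int" where
  "nul F = num_e F - rk F"

text \<open>
  Since the bands are untwisted, a boundary component of the surface that meets some band follows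
  the side of a band from \<open>d\<close> to \<open>opp d\<close> and then the arc of the vertex disc from \<open>opp d\<close> to the next
  half-edge \<open>rot (opp d)\<close>; these components are the orbits of \<open>rot \<circ> opp\<close>, each band side being
  traversed once. Every other boundary component is the boundary circle of the disc of a vertex
  without half-edges.
\<close>

definition boundary_walks :: "('v, 'd) pre_ribbon_graph \<Rightarrow> 'd set set" where
  "boundary_walks F = orbit (rot F \<circ> opp F) ` darts F"

definition isolated_verts :: "('v, 'd) pre_ribbon_graph \<Rightarrow> 'v set" where
  "isolated_verts F = {v \<in> verts F. darts_at F v = {}}"

definition num_p :: "('v, 'd) pre_ribbon_graph \<Rightarrow> int" where
  "num_p F = int (card (boundary_walks F)) + int (card (isolated_verts F))"

text \<open>
  The cyclic order induced on a set \<open>B\<close> of half-edges: the successor of \<open>d\<close> is the first element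
  of \<open>B\<close> met when iterating \<open>rot\<close> from \<open>d\<close>.
\<close>

definition induced_rot :: "('d \<Rightarrow> 'd) \<Rightarrow> 'd set \<Rightarrow> 'd \<Rightarrow> 'd" where
  "induced_rot f B d = (f ^^ (LEAST n. 0 < n \<and> (f ^^ n) d \<in> B)) d"

definition spanning_sub ::
    "('v, 'd) pre_ribbon_graph \<Rightarrow> 'd set set \<Rightarrow> ('v, 'd) pre_ribbon_graph" where
  "spanning_sub F A = F\<lparr>darts := \<Union>A, rot := induced_rot (rot F) (\<Union>A)\<rparr>"

definition states :: "('v, 'd) pre_ribbon_graph \<Rightarrow> ('v, 'd) pre_ribbon_graph set" where
  "states F = {spanning_sub F A | A. A \<subseteq> edges F}"

text \<open>
  The three exponents are non-negative integers for every state of a ribbon graph (the last one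
  is twice the genus), so the integer powers below are ordinary powers.
\<close>

definition BR_poly :: "('v, 'd) pre_ribbon_graph \<Rightarrow> 'a::field \<Rightarrow> 'a \<Rightarrow> 'a \<Rightarrow> 'a" where
  "BR_poly F \<alpha> \<beta> \<gamma> =
     (\<Sum>H\<in>states F. \<alpha> powi (rk F - rk H) * \<beta> powi nul H * \<gamma> powi (num_k H - num_p H + nul H))"

text \<open>
  The tensor product with the \<open>p\<close>-cycle (\<open>p \<ge> 2\<close>): the edge \<open>{d, opp d}\<close> is replaced by a path of
  \<open>p - 1\<close> edges from \<open>vert d\<close> to \<open>vert (opp d)\<close>. With the vertices of this path numbered
  \<open>0, \<dots>, p - 1\<close> starting from \<open>vert d\<close>, the half-edge \<open>(d, i)\<close>, \<open>i < p - 1\<close>, is the one at vertex \<open>i\<close>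
  that points towards vertex \<open>i + 1\<close>. Numbering the path from the other end turns vertex \<open>i\<close> into
  vertex \<open>p - 1 - i\<close>, so the other half of this edge is \<open>(opp d, p - 2 - i)\<close>, and for \<open>i \<ge> 1\<close> the
  other half-edge at vertex \<open>i\<close> is \<open>(opp d, p - 1 - i)\<close>. A new vertex is encoded as the set of its
  two half-edges. The half-edge \<open>(d, 0)\<close> takes the place of \<open>d\<close> in the cyclic order at \<open>vert d\<close>.
\<close>

definition path_vert :: "('v, 'd) pre_ribbon_graph \<Rightarrow> nat \<Rightarrow> 'd \<times> nat \<Rightarrow> ('d \<times> nat) set" where
  "path_vert F p = (\<lambda>(d, i). {(d, i), (opp F d, p - 1 - i)})"

definition tensor_cycle ::
    "('v, 'd) pre_ribbon_graph \<Rightarrow> nat \<Rightarrow> ('v + ('d \<times> nat) set, 'd \<times> nat) pre_ribbon_graph" where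
  "tensor_cycle F p =
     \<lparr>verts = Inl ` verts F \<union> Inr ` path_vert F p ` (darts F \<times> {1..<p - 1}),
      darts = darts F \<times> {..<p - 1},
      vert = (\<lambda>(d, i). if i = 0 then Inl (vert F d) else Inr (path_vert F p (d, i))),
      opp = (\<lambda>(d, i). (opp F d, p - 2 - i)),
      rot = (\<lambda>(d, i). if i = 0 then (rot F d, 0) else (opp F d, p - 1 - i))\<rparr>"

end

theory Submission
  imports Defs
begin

text \<open>
  In \<open>F \<otimes> C\<^sub>p\<close> every edge of \<open>F\<close> becomes a path of \<open>p - 1\<close> edges. Given a state of \<open>F \<otimes> C\<^sub>p\<close>, let
  \<open>H\<close> be the state of \<open>F\<close> formed by the edges whose path is kept completely. Removing a pendant edge
  adds one component and one boundary component, so it changes neither the nullity nor the genus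
  exponent. The edges kept in the incomplete paths can be removed one after the other in this way,
  which leaves the subdivision of \<open>H\<close> together with isolated vertices. So a state over \<open>H\<close> has the
  nullity and the genus exponent of \<open>H\<close>, and its term differs from that of \<open>H\<close> only by a factor
  \<open>\<alpha>\<^bsup>j - 1\<^esup>\<close> for each path with \<open>j \<ge> 1\<close> missing edges. Summing over the states over \<open>H\<close> gives
  \<open>t\<^bsup>e(F) - e(H)\<^esup>\<close>, where \<open>t\<close> is the sum of \<open>(p - 1 choose j) \<alpha>\<^bsup>j - 1\<^esup>\<close> over \<open>j \<ge> 1\<close>, that is, of
  \<open>(\<alpha> + 1)\<^sup>i\<close> over \<open>i < p - 1\<close>. Since \<open>e(F) - e(H) = n(F) + (r(F) - r(H)) - n(H)\<close>, this power of \<open>t\<close>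
  is absorbed by the prefactor and the new arguments. For \<open>p = 3\<close> we have \<open>t = \<alpha> + 2\<close>.

  For the boundary components, passing to a subset of half-edges replaces a permutation by its
  first-return map, whose orbits are the traces of the old orbits on the subset.
\<close>

subsection \<open>Cardinalities and sums\<close>

lemma card_image_eq_if_same_kernel:
  assumes "\<And>x y. x \<in> V \<Longrightarrow> y \<in> V \<Longrightarrow> f x = f y \<longleftrightarrow> g x = g y"
  shows "card (f ` V) = card (g ` V)"
proof -
  define h where "h = g \<circ> inv_into V f"
  have h: "h (f x) = g x" if "x \<in> V" for x
    using that assms[of "inv_into V f (f x)" x] by (simp add: h_def inv_into_into f_inv_into_f)
  then have "h ` f ` V = g ` V" by (simp add: image_image)
  moreover have "inj_on h (f ` V)"
    using h assms by (auto intro!: inj_onI)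
  ultimately show ?thesis by (metis card_image)
qed

lemma card_involution_pairs:
  assumes "finite X" and "\<And>x. x \<in> X \<Longrightarrow> f x \<in> X"
    and "\<And>x. x \<in> X \<Longrightarrow> f (f x) = x" and "\<And>x. x \<in> X \<Longrightarrow> f x \<noteq> x"
  shows "2 * card ((\<lambda>x. {x, f x}) ` X) = card X"
proof -
  have "{x, f x} = {z, f z}" if "x \<in> X" "z \<in> {x, f x}" for x z
    using that assms(3) by auto
  then have eq: "{x, f x} = {y, f y}"
    if "x \<in> X" "y \<in> X" "z \<in> {x, f x}" "z \<in> {y, f y}" for x y z
    using that by metis
  have "2 * card ((\<lambda>x. {x, f x}) ` X) = card (\<Union>((\<lambda>x. {x, f x}) ` X))"
  proof (rule card_partition)
    show "card c = 2" if "c \<in> (\<lambda>x. {x, f x}) ` X" for c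
      using that assms(4) by (force simp: card_2_iff)
    show "c \<inter> c' = {}" if "c \<in> (\<lambda>x. {x, f x}) ` X" "c' \<in> (\<lambda>x. {x, f x}) ` X" "c \<noteq> c'" for c c'
      using that eq by blast
  qed (simp_all add: assms(1))
  also have "\<Union>((\<lambda>x. {x, f x}) ` X) = X" using assms(2) by blast
  finally show ?thesis .
qed

lemma sum_power_proper_subsets:
  fixes a :: "'a::idom"
  assumes "finite P" and "a \<noteq> 0"
  shows "(\<Sum>X\<in>Pow P - {P}. a ^ (card P - 1 - card X)) = (\<Sum>i<card P. (a + 1) ^ i)"
proof -
  have "a * (\<Sum>X\<in>Pow P - {P}. a ^ (card P - 1 - card X)) = (\<Sum>X\<in>Pow P - {P}. a ^ card (P - X))"
    unfolding sum_distrib_left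
  proof (rule sum.cong[OF refl])
    fix X assume X: "X \<in> Pow P - {P}"
    then have "card X < card P" using assms(1) by (intro psubset_card_mono) auto
    then have "card (P - X) = Suc (card P - 1 - card X)"
      using X assms(1) finite_subset[of X P] by (simp add: card_Diff_subset)
    then show "a * a ^ (card P - 1 - card X) = a ^ card (P - X)" by simp
  qed
  also have "\<dots> = (\<Sum>X\<in>Pow P. a ^ card (P - X)) - 1"
    using assms(1) by (subst sum_diff) simp_all
  also have "(\<Sum>X\<in>Pow P. a ^ card (P - X)) = (a + 1) ^ card P"
    using prod_add[OF assms(1), of "\<lambda>_. 1" "\<lambda>_. a"] by (simp add: add.commute)
  also have "\<dots> - 1 = a * (\<Sum>i<card P. (a + 1) ^ i)"
    using power_diff_1_eq[of "a + 1" "card P"] by simp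
  finally show ?thesis using \<open>a \<noteq> 0\<close> by simp
qed

lemma exists_consecutive_change:
  assumes "i < n" and "j < n" and "P i \<noteq> P j"
  shows "\<exists>k. Suc k < n \<and> P k \<noteq> P (Suc k)"
proof (rule ccontr)
  assume const: "\<not> ?thesis"
  have "P k = P 0" if "k < n" for k
    using that by (induction k) (use const in auto)
  then show False using assms by metis
qed

subsection \<open>First-return maps\<close>

inductive first_hit :: "('a \<Rightarrow> 'a) \<Rightarrow> 'a set \<Rightarrow> 'a \<Rightarrow> 'a \<Rightarrow> bool" for f B where
  now: "f d \<in> B \<Longrightarrow> first_hit f B d (f d)"
| later: "f d \<notin> B \<Longrightarrow> first_hit f B (f d) e \<Longrightarrow> first_hit f B d e"

lemma first_hit_in_orbit: "first_hit f B d e \<Longrightarrow> e \<in> orbit f d \<inter> B"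
  by (induction rule: first_hit.induct) (auto intro: orbit.base orbit_subset)

lemma induced_rot_now: "f d \<in> B \<Longrightarrow> induced_rot f B d = f d"
proof -
  assume "f d \<in> B"
  then have "(LEAST n. 0 < n \<and> (f ^^ n) d \<in> B) = 1"
    by (intro Least_equality) auto
  then show ?thesis by (simp add: induced_rot_def)
qed

lemma induced_rot_later:
  assumes "f d \<notin> B" and "orbit f (f d) \<inter> B \<noteq> {}"
  shows "induced_rot f B d = induced_rot f B (f d)"
proof -
  have shift: "(f ^^ Suc m) d = (f ^^ m) (f d)" for m
    by (simp only: funpow_Suc_right comp_apply)
  have pos: "0 < Suc m \<and> (f ^^ Suc m) d \<in> B \<longleftrightarrow> 0 < m \<and> (f ^^ m) (f d) \<in> B" for m
    using assms(1) unfolding shift by (cases m) auto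
  obtain n where "0 < n" "(f ^^ n) (f d) \<in> B"
    using assms(2) by (auto simp: orbit_altdef)
  then have "(LEAST n. 0 < n \<and> (f ^^ n) d \<in> B) = Suc (LEAST m. 0 < Suc m \<and> (f ^^ Suc m) d \<in> B)"
    using assms(1) pos[of n] by (intro Least_Suc[of _ "Suc n"]) simp_all
  then show ?thesis
    unfolding induced_rot_def pos by (simp only: shift)
qed

lemma induced_rot_eq_if_first_hit: "first_hit f B d e \<Longrightarrow> induced_rot f B d = e"
proof (induction rule: first_hit.induct)
  case (now d)
  then show ?case by (rule induced_rot_now)
next
  case (later d e)
  then show ?case using induced_rot_later[of f d B] first_hit_in_orbit[of f B "f d" e] by auto
qed

lemma first_hit_exists:
  assumes "e \<in> orbit f d" and "e \<in> B"
  shows "\<exists>z. first_hit f B d z \<and> (z = e \<or> e \<in> orbit (induced_rot f B) z)"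
proof -
  obtain n where "(f ^^ Suc n) d = e"
    using assms(1) by (auto simp: orbit_altdef gr0_conv_Suc)
  then show ?thesis
  proof (induction n arbitrary: d)
    case 0
    then show ?case using assms(2) by (auto intro: first_hit.now)
  next
    case (Suc n)
    have "(f ^^ Suc n) (f d) = e"
      using Suc.prems by (simp add: funpow_swap1)
    then obtain z where z: "first_hit f B (f d) z" "z = e \<or> e \<in> orbit (induced_rot f B) z"
      using Suc.IH by blast
    show ?case
    proof (cases "f d \<in> B")
      case True
      have "induced_rot f B (f d) = z"
        using z(1) by (rule induced_rot_eq_if_first_hit)
      with z(2) have "e \<in> orbit (induced_rot f B) (f d)"
        by (auto intro: orbit.base orbit_subset)
      with True show ?thesis by (blast intro: first_hit.now)
    next
      case False
      with z show ?thesis by (blast intro: first_hit.later)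
    qed
  qed
qed

lemma first_hit_induced_rot:
  assumes "orbit f d \<inter> B \<noteq> {}"
  shows "first_hit f B d (induced_rot f B d)"
  using assms first_hit_exists induced_rot_eq_if_first_hit by (metis disjoint_iff)

lemma first_hit_of_induced_rot:
  assumes "first_hit f T d e" and "T \<subseteq> S"
  shows "first_hit (induced_rot f S) T d e"
  using assms(1)
proof (induction rule: first_hit.induct)
  case (now d)
  then have "induced_rot f S d = f d"
    using assms(2) by (blast intro: induced_rot_now)
  with now show ?case by (metis first_hit.now)
next
  case (later d e)
  show ?case
  proof (cases "f d \<in> S")
    case True
    then have "induced_rot f S d = f d" by (rule induced_rot_now)
    with later show ?thesis by (metis first_hit.later)
  next
    case False
    have "orbit f (f d) \<inter> S \<noteq> {}"
      using first_hit_in_orbit[OF later.hyps(2)] assms(2) by blast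
    then have "induced_rot f S d = induced_rot f S (f d)"
      using False by (intro induced_rot_later)
    with later.IH show ?thesis
      by (metis first_hit.simps)
  qed
qed

lemma first_hit_semiconj:
  assumes "first_hit f S d e"
    and "\<And>x. f' (h x) = h (f x)" and "\<And>x. h x \<in> S' \<longleftrightarrow> x \<in> S"
  shows "first_hit f' S' (h d) (h e)"
  using assms(1)
proof (induction rule: first_hit.induct)
  case (now d)
  then show ?case using first_hit.now[of f' "h d" S'] assms(2,3) by simp
next
  case (later d e)
  then show ?case using first_hit.later[of f' "h d" S'] assms(2,3) by simp
qed

subsection \<open>Orbits of bijections of a finite set\<close>

lemma orbit_eq_if_in_orbit:
  assumes "x \<in> orbit f x" and "y \<in> orbit f x"
  shows "orbit f y = orbit f x"
  using orbit_swap[OF assms] assms(2) by (blast intro: orbit_trans)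

lemma orbit_doubleton:
  assumes "f x = y" and "f y = x"
  shows "orbit f x = {x, y}"
proof
  show "orbit f x \<subseteq> {x, y}"
  proof
    fix z assume "z \<in> orbit f x"
    then show "z \<in> {x, y}" by induction (use assms in auto)
  qed
  show "{x, y} \<subseteq> orbit f x"
    using assms orbit.base[of f x] orbit.step[of y f x] by auto
qed

lemma orbit_subset_if_maps_to:
  assumes "f \<in> X \<rightarrow> X" and "x \<in> X"
  shows "orbit f x \<subseteq> X"
proof
  fix y assume "y \<in> orbit f x"
  then show "y \<in> X" by induction (use assms in auto)
qed

lemma bij_betw_iff_self_in_orbit:
  assumes "finite X"
  shows "bij_betw f X X \<longleftrightarrow> f \<in> X \<rightarrow> X \<and> (\<forall>x\<in>X. x \<in> orbit f x)"
proof (intro iffI conjI ballI)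
  assume bij: "bij_betw f X X"
  then show maps_to: "f \<in> X \<rightarrow> X" by (auto simp: bij_betw_def)
  fix x assume x: "x \<in> X"
  have "restrict_id f X permutes X"
    using bij by (rule permutes_restrict_id)
  then have "permutation (restrict_id f X)"
    using assms by (auto simp: permutation_permutes)
  then have "x \<in> orbit (restrict_id f X) x"
    by (rule permutation_self_in_orbit)
  also have "orbit (restrict_id f X) x = orbit f x"
    using x maps_to by (intro orbit_cong0[symmetric]) auto
  finally show "x \<in> orbit f x" .
next
  assume f: "f \<in> X \<rightarrow> X \<and> (\<forall>x\<in>X. x \<in> orbit f x)"
  have "x \<in> f ` X" if "x \<in> X" for x
  proof -
    have "x \<in> orbit f x" using f that by blast
    then show ?thesis
      by cases (use that f orbit_subset_if_maps_to[of f X x] in auto)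
  qed
  with f have "f ` X = X" by blast
  then show "bij_betw f X X"
    using assms finite_surj_inj[of X f] by (simp add: bij_betw_def)
qed

context
  fixes f :: "'a \<Rightarrow> 'a" and X :: "'a set"
  assumes fin: "finite X" and bij: "bij_betw f X X"
begin

lemma self_in_orbit: "x \<in> X \<Longrightarrow> x \<in> orbit f x"
  using fin bij bij_betw_iff_self_in_orbit by blast

lemma orbit_subset_carrier: "x \<in> X \<Longrightarrow> orbit f x \<subseteq> X"
  using bij orbit_subset_if_maps_to[of f X] by (auto simp: bij_betw_def)

lemma first_hit_return: "B \<subseteq> X \<Longrightarrow> d \<in> B \<Longrightarrow> first_hit f B d (induced_rot f B d)"
  using self_in_orbit by (intro first_hit_induced_rot) blast

lemma orbit_induced_rot:
  assumes "B \<subseteq> X" and "d \<in> B"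
  shows "orbit (induced_rot f B) d = orbit f d \<inter> B"
proof
  note hit = first_hit_return[OF assms(1), THEN first_hit_in_orbit]
  show "orbit (induced_rot f B) d \<subseteq> orbit f d \<inter> B"
  proof
    fix y assume "y \<in> orbit (induced_rot f B) d"
    then show "y \<in> orbit f d \<inter> B"
    proof induction
      case base
      show ?case using hit[OF assms(2)] .
    next
      case (step y)
      then show ?case using hit[of y] by (blast intro: orbit_trans)
    qed
  qed
  show "orbit f d \<inter> B \<subseteq> orbit (induced_rot f B) d"
  proof
    fix e assume "e \<in> orbit f d \<inter> B"
    then obtain z where "first_hit f B d z" "z = e \<or> e \<in> orbit (induced_rot f B) z"
      using first_hit_exists by (metis IntE)
    moreover from this(1) have "induced_rot f B d = z"
      by (rule induced_rot_eq_if_first_hit)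
    ultimately show "e \<in> orbit (induced_rot f B) d"
      by (auto intro: orbit.base orbit_subset)
  qed
qed

lemma bij_betw_induced_rot:
  assumes "B \<subseteq> X"
  shows "bij_betw (induced_rot f B) B B"
proof -
  have "finite B" using assms fin by (rule finite_subset)
  moreover have "induced_rot f B \<in> B \<rightarrow> B"
    using first_hit_return[OF assms, THEN first_hit_in_orbit] by blast
  moreover have "d \<in> orbit (induced_rot f B) d" if "d \<in> B" for d
    using orbit_induced_rot[OF assms that] self_in_orbit that assms by auto
  ultimately show ?thesis by (simp add: bij_betw_iff_self_in_orbit)
qed

lemma card_orbits_induced_rot:
  assumes "B \<subseteq> X"
  shows "card (orbit (induced_rot f B) ` B) = card (orbit f ` B)"
proof -
  have "orbit (induced_rot f B) ` B = (\<lambda>Z. Z \<inter> B) ` orbit f ` B"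
    using orbit_induced_rot[OF assms] by (force simp: image_image)
  moreover have "inj_on (\<lambda>Z. Z \<inter> B) (orbit f ` B)"
  proof (rule inj_onI, clarify)
    fix x y assume "x \<in> B" "y \<in> B" "orbit f x \<inter> B = orbit f y \<inter> B"
    then have "x \<in> orbit f y" "y \<in> orbit f y" using self_in_orbit assms by blast+
    then show "orbit f x = orbit f y" by (rule orbit_eq_if_in_orbit[rotated])
  qed
  ultimately show ?thesis by (simp add: card_image)
qed

lemma induced_rot_induced_rot:
  assumes "T \<subseteq> S" and "S \<subseteq> X" and "d \<in> T"
  shows "induced_rot (induced_rot f S) T d = induced_rot f T d"
proof -
  have "first_hit f T d (induced_rot f T d)"
    using assms by (intro first_hit_return) auto
  then have "first_hit (induced_rot f S) T d (induced_rot f T d)"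
    using assms(1) by (rule first_hit_of_induced_rot)
  then show ?thesis by (rule induced_rot_eq_if_first_hit)
qed

end

subsection \<open>Quotients by reachability\<close>

lemma rtrancl_Image_eq_iff: "sym R \<Longrightarrow> R\<^sup>* `` {x} = R\<^sup>* `` {y} \<longleftrightarrow> (x, y) \<in> R\<^sup>*"
  by (rule eq_equiv_class_iff[of UNIV])
    (auto simp: equiv_def refl_rtrancl sym_rtrancl trans_rtrancl)

lemma rtrancl_Image_not_Domain: "x \<notin> Domain R \<Longrightarrow> R\<^sup>* `` {x} = {x}"
  by (auto simp: Not_Domain_rtrancl)

lemma rtrancl_map:
  assumes "(x, y) \<in> R\<^sup>*" and "\<And>x y. (x, y) \<in> R \<Longrightarrow> (f x, f y) \<in> S\<^sup>*"
  shows "(f x, f y) \<in> S\<^sup>*"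
  using assms(1) by induction (auto intro: rtrancl_trans assms(2))

lemma quotient_eq_image: "V // R = (\<lambda>x. R `` {x}) ` V"
  by (auto simp: quotient_def)

lemma card_quotient_rtrancl_eq:
  assumes "sym R" and "sym S" and f_in: "f \<in> V \<rightarrow> W" and g_in: "g \<in> W \<rightarrow> V"
    and f: "\<And>x y. (x, y) \<in> R \<Longrightarrow> (f x, f y) \<in> S\<^sup>*"
    and g: "\<And>x y. (x, y) \<in> S \<Longrightarrow> (g x, g y) \<in> R\<^sup>*"
    and gf: "\<And>x. x \<in> V \<Longrightarrow> (x, g (f x)) \<in> R\<^sup>*"
    and fg: "\<And>y. y \<in> W \<Longrightarrow> (y, f (g y)) \<in> S\<^sup>*"
  shows "card (V // R\<^sup>*) = card (W // S\<^sup>*)"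
proof -
  have f_star: "(f x, f y) \<in> S\<^sup>*" if "(x, y) \<in> R\<^sup>*" for x y
    using that f by (rule rtrancl_map)
  have g_star: "(g x, g y) \<in> R\<^sup>*" if "(x, y) \<in> S\<^sup>*" for x y
    using that g by (rule rtrancl_map)
  have "(x, y) \<in> R\<^sup>* \<longleftrightarrow> (f x, f y) \<in> S\<^sup>*" if "x \<in> V" "y \<in> V" for x y
  proof
    assume "(f x, f y) \<in> S\<^sup>*"
    then have "(g (f x), g (f y)) \<in> R\<^sup>*" by (rule g_star)
    moreover have "(g (f y), y) \<in> R\<^sup>*"
      using gf[OF that(2)] sym_rtrancl[OF \<open>sym R\<close>] by (rule symD[rotated])
    ultimately show "(x, y) \<in> R\<^sup>*" using gf[OF that(1)] by (meson rtrancl_trans)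
  qed (rule f_star)
  then have "card (V // R\<^sup>*) = card ((\<lambda>x. S\<^sup>* `` {f x}) ` V)"
    unfolding quotient_eq_image
    by (intro card_image_eq_if_same_kernel)
      (simp add: rtrancl_Image_eq_iff[OF \<open>sym R\<close>] rtrancl_Image_eq_iff[OF \<open>sym S\<close>])
  also have "(\<lambda>x. S\<^sup>* `` {f x}) ` V = W // S\<^sup>*"
  proof
    have "S\<^sup>* `` {y} = S\<^sup>* `` {f (g y)}" if "y \<in> W" for y
      using fg[OF that] rtrancl_Image_eq_iff[OF \<open>sym S\<close>] by blast
    then show "W // S\<^sup>* \<subseteq> (\<lambda>x. S\<^sup>* `` {f x}) ` V"
      using g_in unfolding quotient_eq_image by blast
  qed (use f_in in \<open>auto simp: quotient_eq_image\<close>)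
  finally show ?thesis .
qed

subsection \<open>Ribbon graphs and their spanning subgraphs\<close>

lemma spanning_sub_simps [simp]:
  "verts (spanning_sub F A) = verts F"
  "darts (spanning_sub F A) = \<Union>A"
  "vert (spanning_sub F A) = vert F"
  "opp (spanning_sub F A) = opp F"
  "rot (spanning_sub F A) = induced_rot (rot F) (\<Union>A)"
  by (simp_all add: spanning_sub_def)

definition boundary_step :: "('v, 'd) pre_ribbon_graph \<Rightarrow> 'd \<Rightarrow> 'd" where
  "boundary_step F d = rot F (opp F d)"

lemma boundary_walks_eq: "boundary_walks F = orbit (boundary_step F) ` darts F"
  by (simp add: boundary_walks_def boundary_step_def[abs_def] comp_def)

lemma num_v_spanning_sub [simp]: "num_v (spanning_sub F A) = num_v F"
  by (simp add: num_v_def)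

context ribbon_graph
begin

lemma finite_edges: "finite (edges F)"
  by (simp add: edges_def finite_darts)

lemma edge_of_dart: "d \<in> darts F \<Longrightarrow> {d, opp F d} \<in> edges F"
  by (simp add: edges_def)

lemma edge_eq: "e \<in> edges F \<Longrightarrow> d \<in> e \<Longrightarrow> e = {d, opp F d}"
  by (auto simp: edges_def opp_opp)

lemma edge_unique: "e \<in> edges F \<Longrightarrow> e' \<in> edges F \<Longrightarrow> d \<in> e \<Longrightarrow> d \<in> e' \<Longrightarrow> e = e'"
  using edge_eq[of e d] edge_eq[of e' d] by simp

lemma Union_edges: "\<Union>(edges F) = darts F"
  by (auto simp: edges_def opp_in_darts)

lemma Union_edges_Diff: "A \<subseteq> edges F \<Longrightarrow> B \<subseteq> edges F \<Longrightarrow> \<Union>(A - B) = \<Union>A - \<Union>B"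
  by (auto dest: subsetD edge_unique)

lemma darts_at_spanning_sub:
  "A \<subseteq> edges F \<Longrightarrow> darts_at (spanning_sub F A) v = darts_at F v \<inter> \<Union>A"
  using Union_edges by (auto simp: darts_at_def)

lemma opp_in_Union_iff:
  assumes "A \<subseteq> edges F" and "d \<in> darts F"
  shows "opp F d \<in> \<Union>A \<longleftrightarrow> d \<in> \<Union>A"
proof -
  have "opp F x \<in> \<Union>A" if "x \<in> \<Union>A" for x
    using that assms(1) edge_eq by blast
  from this[of d] this[of "opp F d"] show ?thesis
    using opp_opp[OF assms(2)] by auto
qed

lemma edges_spanning_sub:
  assumes "A \<subseteq> edges F"
  shows "edges (spanning_sub F A) = A"
proof -
  have "(\<lambda>d. {d, opp F d}) ` e = {e}" if "e \<in> A" for e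
  proof -
    have "e \<in> edges F" using that assms by blast
    then have "e \<noteq> {}" "\<And>d. d \<in> e \<Longrightarrow> {d, opp F d} = e"
      by (auto simp: edges_def) (auto simp: opp_opp)
    then show ?thesis by auto
  qed
  then show ?thesis
    by (simp add: edges_def image_Union)
qed

lemma card_Union_edges:
  assumes "A \<subseteq> edges F"
  shows "2 * card A = card (\<Union>A)"
proof -
  have "\<Union>A \<subseteq> darts F" using assms Union_edges by blast
  moreover from this have "opp F d \<in> \<Union>A" if "d \<in> \<Union>A" for d
    using that opp_in_Union_iff[OF assms] by blast
  ultimately have "2 * card ((\<lambda>d. {d, opp F d}) ` \<Union>A) = card (\<Union>A)"
    using finite_darts opp_neq opp_opp
    by (intro card_involution_pairs) (auto intro: finite_subset dest: subsetD)
  then show ?thesis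
    using edges_spanning_sub[OF assms] by (simp add: edges_def)
qed

lemma num_e_spanning_sub: "A \<subseteq> edges F \<Longrightarrow> num_e (spanning_sub F A) = int (card A)"
  by (simp add: num_e_def edges_spanning_sub)

lemma card_edges_Diff:
  assumes "A \<subseteq> edges F"
  shows "int (card (edges F - A)) = num_e F - int (card A)"
  using assms finite_edges finite_subset[OF assms finite_edges]
  by (simp add: num_e_def card_Diff_subset card_mono of_nat_diff)

lemma orbit_rot: "d \<in> darts F \<Longrightarrow> orbit (rot F) d = darts_at F (vert F d)"
  by (rule orbit_cyclic_eq3, rule rot_cyclic) (auto simp: darts_at_def vert_in_verts)

lemma bij_betw_rot: "bij_betw (rot F) (darts F) (darts F)"
proof -
  have "d \<in> orbit (rot F) d" "rot F d \<in> darts F" if "d \<in> darts F" for d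
    using orbit_rot[OF that] orbit.base[of "rot F" d] that by (auto simp: darts_at_def)
  then show ?thesis by (simp add: bij_betw_iff_self_in_orbit finite_darts)
qed

lemma bij_betw_boundary_step: "bij_betw (boundary_step F) (darts F) (darts F)"
proof -
  have "bij_betw (opp F) (darts F) (darts F)"
    by (rule bij_betw_byWitness[of _ "opp F"]) (auto simp: opp_opp opp_in_darts)
  then have "bij_betw (rot F \<circ> opp F) (darts F) (darts F)"
    using bij_betw_rot by (rule bij_betw_trans)
  then show ?thesis by (simp add: boundary_step_def[abs_def] comp_def)
qed

lemma self_in_orbit_boundary_step: "x \<in> darts F \<Longrightarrow> x \<in> orbit (boundary_step F) x"
  using finite_darts bij_betw_boundary_step by (rule self_in_orbit)

lemma rot_in_darts: "d \<in> darts F \<Longrightarrow> rot F d \<in> darts F"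
  using bij_betw_rot by (auto simp: bij_betw_def)

lemma boundary_walks_cong:
  assumes "darts G = darts F"
    and "\<And>d. d \<in> darts F \<Longrightarrow> opp G d = opp F d"
    and "\<And>d. d \<in> darts F \<Longrightarrow> rot G d = rot F d"
  shows "boundary_walks G = boundary_walks F"
proof -
  have "orbit (boundary_step F) d = orbit (boundary_step G) d" if "d \<in> darts F" for d
    using that assms(2,3)
    by (intro orbit_cong0) (auto simp: boundary_step_def opp_in_darts rot_in_darts)
  then show ?thesis by (simp add: boundary_walks_eq assms(1))
qed

lemma ribbon_graph_spanning_sub:
  assumes "A \<subseteq> edges F"
  shows "ribbon_graph (spanning_sub F A)"
proof
  have A: "\<Union>A \<subseteq> darts F" using assms Union_edges by blast
  show "finite (verts (spanning_sub F A))" by (simp add: finite_verts)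
  show "finite (darts (spanning_sub F A))" using A finite_darts finite_subset by auto
  fix d assume "d \<in> darts (spanning_sub F A)"
  then obtain e where e: "e \<in> A" "d \<in> e" by auto
  then have d: "d \<in> darts F" "e = {d, opp F d}" using A assms edge_eq by auto
  then show "vert (spanning_sub F A) d \<in> verts (spanning_sub F A)"
    "opp (spanning_sub F A) d \<noteq> d"
    "opp (spanning_sub F A) (opp (spanning_sub F A) d) = d"
    by (simp_all add: vert_in_verts opp_neq opp_opp)
  show "opp (spanning_sub F A) d \<in> darts (spanning_sub F A)" using e d by auto
next
  have A: "\<Union>A \<subseteq> darts F" using assms Union_edges by blast
  fix v assume "darts_at (spanning_sub F A) v \<noteq> {}"
  then obtain d where d: "d \<in> darts_at F v" "d \<in> \<Union>A"
    using darts_at_spanning_sub[OF assms] by blast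
  then have "orbit (induced_rot (rot F) (\<Union>A)) d = darts_at F v \<inter> \<Union>A"
    using orbit_induced_rot[OF finite_darts bij_betw_rot A] orbit_rot by (simp add: darts_at_def)
  with d show "cyclic_on (rot (spanning_sub F A)) (darts_at (spanning_sub F A) v)"
    by (intro cyclic_on_singleI[of d]) (auto simp: darts_at_spanning_sub[OF assms])
qed

lemma boundary_walks_spanning_sub_spanning_sub:
  assumes "A \<subseteq> edges F" and "B \<subseteq> A"
  shows "boundary_walks (spanning_sub (spanning_sub F A) B) = boundary_walks (spanning_sub F B)"
proof (rule ribbon_graph.boundary_walks_cong)
  show "ribbon_graph (spanning_sub F B)"
    using assms by (intro ribbon_graph_spanning_sub) auto
  show "rot (spanning_sub (spanning_sub F A) B) d = rot (spanning_sub F B) d"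
    if "d \<in> darts (spanning_sub F B)" for d
    using that assms Union_edges unfolding spanning_sub_simps
    by (intro induced_rot_induced_rot[OF finite_darts bij_betw_rot]) auto
qed simp_all

lemma num_p_spanning_sub_spanning_sub:
  assumes "A \<subseteq> edges F" and "B \<subseteq> A"
  shows "num_p (spanning_sub (spanning_sub F A) B) = num_p (spanning_sub F B)"
  using boundary_walks_spanning_sub_spanning_sub[OF assms]
  by (simp add: num_p_def isolated_verts_def darts_at_def)

lemma num_k_spanning_sub_spanning_sub:
  "num_k (spanning_sub (spanning_sub F A) B) = num_k (spanning_sub F B)"
  by (simp add: num_k_def components_def adjacency_def)

lemma adjacency_dart: "d \<in> darts F \<Longrightarrow> (vert F d, vert F (opp F d)) \<in> adjacency F"
  by (simp add: adjacency_def)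

lemma sym_adjacency: "sym (adjacency F)"
  unfolding adjacency_def by (rule symI) (force simp: opp_opp opp_in_darts)

lemma connected_sym: "(v, w) \<in> (adjacency F)\<^sup>* \<Longrightarrow> (w, v) \<in> (adjacency F)\<^sup>*"
  using sym_rtrancl[OF sym_adjacency] by (rule symD)

lemma adjacency_subset: "adjacency F \<subseteq> verts F \<times> verts F"
  by (auto simp: adjacency_def vert_in_verts opp_in_darts)

lemma components_eq_image: "components F = (\<lambda>v. (adjacency F)\<^sup>* `` {v}) ` verts F"
  by (simp add: components_def quotient_eq_image)

lemma finite_components: "finite (components F)"
  by (simp add: components_eq_image finite_verts)

end

subsection \<open>Pendant edges and isolated vertices\<close>

definition remove_edge :: "('v, 'd) pre_ribbon_graph \<Rightarrow> 'd \<Rightarrow> ('v, 'd) pre_ribbon_graph" where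
  "remove_edge F d = spanning_sub F (edges F - {{d, opp F d}})"

definition pendant_dart :: "('v, 'd) pre_ribbon_graph \<Rightarrow> 'd \<Rightarrow> bool" where
  "pendant_dart F d \<longleftrightarrow> d \<in> darts F \<and> darts_at F (vert F d) = {d}"

lemma remove_edge_simps [simp]:
  "verts (remove_edge F d) = verts F"
  "vert (remove_edge F d) = vert F"
  "opp (remove_edge F d) = opp F"
  "rot (remove_edge F d) = induced_rot (rot F) (darts (remove_edge F d))"
  by (simp_all add: remove_edge_def)

context ribbon_graph
begin

lemma ribbon_graph_remove_edge: "ribbon_graph (remove_edge F d)"
  unfolding remove_edge_def by (rule ribbon_graph_spanning_sub) auto

lemma darts_remove_edge:
  "d \<in> darts F \<Longrightarrow> darts (remove_edge F d) = darts F - {d, opp F d}"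
  using Union_edges_Diff[of "edges F" "{{d, opp F d}}"]
  by (simp add: remove_edge_def edge_of_dart Union_edges)

context
  fixes d :: 'd
  assumes pendant: "pendant_dart F d"
begin

lemma pendant_dart_in_darts: "d \<in> darts F"
  and darts_at_pendant_dart: "darts_at F (vert F d) = {d}"
  using pendant by (simp_all add: pendant_dart_def)

lemma vert_eq_pendant_iff: "x \<in> darts F \<Longrightarrow> vert F x = vert F d \<longleftrightarrow> x = d"
  using darts_at_pendant_dart by (auto simp: darts_at_def)

lemma adjacency_remove_pendant_edge:
  defines "v \<equiv> vert F d" and "w \<equiv> vert F (opp F d)"
    and "S \<equiv> adjacency (remove_edge F d)"
  shows "w \<noteq> v" and "adjacency F = S \<union> {(v, w), (w, v)}" and "v \<notin> Domain S" and "v \<notin> Range S"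
proof -
  have S: "S = (\<lambda>x. (vert F x, vert F (opp F x))) ` (darts F - {d, opp F d})"
    by (simp add: S_def adjacency_def darts_remove_edge[OF pendant_dart_in_darts])
  show "w \<noteq> v"
    using vert_eq_pendant_iff[of "opp F d"] pendant_dart_in_darts
    by (simp add: v_def w_def opp_in_darts opp_neq)
  have "darts F = (darts F - {d, opp F d}) \<union> {d, opp F d}"
    using pendant_dart_in_darts opp_in_darts by auto
  then have "adjacency F =
      (\<lambda>x. (vert F x, vert F (opp F x))) ` ((darts F - {d, opp F d}) \<union> {d, opp F d})"
    unfolding adjacency_def by (rule arg_cong)
  then show "adjacency F = S \<union> {(v, w), (w, v)}"
    using pendant_dart_in_darts by (simp add: S image_Un v_def w_def opp_opp)
  have "vert F x \<noteq> v \<and> vert F (opp F x) \<noteq> v" if "x \<in> darts F - {d, opp F d}" for x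
    using that vert_eq_pendant_iff[of x] vert_eq_pendant_iff[of "opp F x"] opp_in_darts opp_opp
    by (auto simp: v_def)
  then show "v \<notin> Domain S" "v \<notin> Range S" by (auto simp: S)
qed

lemma num_k_remove_pendant_edge: "num_k (remove_edge F d) = num_k F + 1"
proof -
  define G where "G = remove_edge F d"
  interpret G: ribbon_graph G unfolding G_def by (rule ribbon_graph_remove_edge)
  define v where "v = vert F d"
  define w where "w = vert F (opp F d)"
  have adj: "w \<noteq> v" "adjacency F = adjacency G \<union> {(v, w), (w, v)}"
    "v \<notin> Domain (adjacency G)" "v \<notin> Range (adjacency G)"
    unfolding v_def w_def G_def by (rule adjacency_remove_pendant_edge)+
  have v: "v \<in> verts F" and w: "w \<in> verts F - {v}"
    using pendant_dart_in_darts adj(1) by (simp_all add: v_def w_def vert_in_verts opp_in_darts)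
  have "card (components F) = card ((verts F - {v}) // (adjacency G)\<^sup>*)"
    unfolding components_def
  proof (rule card_quotient_rtrancl_eq[OF sym_adjacency G.sym_adjacency])
    let ?f = "\<lambda>x. if x = v then w else x"
    show "?f \<in> verts F \<rightarrow> verts F - {v}" "(\<lambda>x. x) \<in> verts F - {v} \<rightarrow> verts F"
      using w by auto
    show "(?f x, ?f y) \<in> (adjacency G)\<^sup>*" if "(x, y) \<in> adjacency F" for x y
      using that adj by auto
  qed (use adj in auto)
  moreover have "verts G = insert v (verts F - {v})"
    using v by (auto simp: G_def)
  then have "components G = insert {v} ((verts F - {v}) // (adjacency G)\<^sup>*)"
    by (simp only: G.components_eq_image quotient_eq_image image_insert
        rtrancl_Image_not_Domain[OF adj(3)])
  moreover have "{v} \<notin> (verts F - {v}) // (adjacency G)\<^sup>*"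
    by (auto simp: quotient_eq_image)
  ultimately have "card (components G) = card (components F) + 1"
    by (simp add: finite_verts quotient_eq_image)
  then show ?thesis by (simp add: num_k_def G_def)
qed

lemma rot_pendant_dart: "rot F d = d"
  using orbit_rot[OF pendant_dart_in_darts] darts_at_pendant_dart
  by (simp add: orbit_eq_singleton_iff)

lemma boundary_step_opp_pendant_dart: "boundary_step F (opp F d) = d"
  using pendant_dart_in_darts by (simp add: boundary_step_def opp_opp rot_pendant_dart)

lemma first_hit_boundary_step_if_first_hit_rot:
  assumes "first_hit (rot F) (darts F - {d, opp F d}) x y" and "x \<in> darts F"
  shows "first_hit (boundary_step F) (darts F - {d, opp F d}) (opp F x) y"
  using assms
proof (induction rule: first_hit.induct)
  case (now x)
  then have "boundary_step F (opp F x) = rot F x"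
    by (simp add: boundary_step_def opp_opp)
  with now.hyps show ?case by (metis first_hit.now)
next
  case (later x y)
  have "rot F x \<noteq> d"
    using first_hit_in_orbit[OF later.hyps(2)] orbit_rot[OF pendant_dart_in_darts]
      darts_at_pendant_dart by auto
  then have rot_x: "rot F x = opp F d"
    using later.hyps(1) rot_in_darts[OF later.prems] by simp
  then have "first_hit (boundary_step F) (darts F - {d, opp F d}) d y"
    using later.IH pendant_dart_in_darts by (simp add: opp_in_darts opp_opp)
  then have "first_hit (boundary_step F) (darts F - {d, opp F d}) (opp F d) y"
    using first_hit.later[of "boundary_step F" "opp F d"]
    by (simp add: boundary_step_opp_pendant_dart)
  moreover have "boundary_step F (opp F x) = opp F d"
    using rot_x later.prems by (simp add: boundary_step_def opp_opp)
  ultimately show ?case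
    using first_hit.later[of "boundary_step F" "opp F x"] by simp
qed

lemma card_boundary_walks_remove_pendant_edge_eq_card_orbits:
  "card (boundary_walks (remove_edge F d)) =
    card (orbit (boundary_step F) ` (darts F - {d, opp F d}))"
proof -
  define B where "B = darts F - {d, opp F d}"
  define G where "G = remove_edge F d"
  have B: "B \<subseteq> darts F" and opp_B: "x \<in> B \<Longrightarrow> opp F x \<in> B" for x
    using opp_in_darts[of x] opp_opp[of x] opp_opp[OF pendant_dart_in_darts] by (auto simp: B_def)
  have "induced_rot (boundary_step F) B x = boundary_step G x" if "x \<in> B" for x
  proof -
    have "first_hit (rot F) B (opp F x) (induced_rot (rot F) B (opp F x))"
      using finite_darts bij_betw_rot B opp_B[OF that] by (rule first_hit_return)
    then have "first_hit (boundary_step F) B (opp F (opp F x)) (induced_rot (rot F) B (opp F x))"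
      unfolding B_def using that B
      by (intro first_hit_boundary_step_if_first_hit_rot) (auto simp: opp_in_darts)
    then have "first_hit (boundary_step F) B x (boundary_step G x)"
      using that B opp_opp[of x]
      by (auto simp: boundary_step_def G_def darts_remove_edge[OF pendant_dart_in_darts] B_def)
    then show ?thesis by (rule induced_rot_eq_if_first_hit)
  qed
  moreover have "induced_rot (boundary_step F) B \<in> B \<rightarrow> B"
    using bij_betw_induced_rot[OF finite_darts bij_betw_boundary_step B]
    by (auto simp: bij_betw_def)
  ultimately have "orbit (induced_rot (boundary_step F) B) ` B = orbit (boundary_step G) ` B"
    by (intro image_cong refl orbit_cong0)
  then have "boundary_walks G = orbit (induced_rot (boundary_step F) B) ` B"
    by (simp add: boundary_walks_eq G_def darts_remove_edge[OF pendant_dart_in_darts] B_def)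
  then show ?thesis
    using card_orbits_induced_rot[OF finite_darts bij_betw_boundary_step B]
    by (simp add: G_def B_def)
qed

lemma boundary_walks_pendant_edge:
  "boundary_walks F =
    insert (orbit (boundary_step F) d) (orbit (boundary_step F) ` (darts F - {d, opp F d}))"
proof -
  have orbit_opp: "orbit (boundary_step F) (opp F d) = orbit (boundary_step F) d"
    using self_in_orbit_step[OF self_in_orbit_boundary_step[of "opp F d"]] pendant_dart_in_darts
    by (simp add: opp_in_darts boundary_step_opp_pendant_dart)
  have "darts F = insert d (insert (opp F d) (darts F - {d, opp F d}))"
    using pendant_dart_in_darts opp_in_darts by auto
  then have "boundary_walks F =
      orbit (boundary_step F) ` insert d (insert (opp F d) (darts F - {d, opp F d}))"
    unfolding boundary_walks_eq by (rule arg_cong)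
  then show ?thesis by (simp only: image_insert orbit_opp insert_absorb2)
qed

lemma orbit_pendant_dart_in_iff:
  "orbit (boundary_step F) d \<in> orbit (boundary_step F) ` (darts F - {d, opp F d}) \<longleftrightarrow>
    darts_at F (vert F (opp F d)) \<noteq> {opp F d}"
proof -
  have "darts_at F (vert F (opp F d)) = {opp F d} \<longleftrightarrow> boundary_step F d = opp F d"
    using orbit_rot[of "opp F d"] pendant_dart_in_darts orbit_eq_singleton_iff[of "rot F" "opp F d"]
    by (simp add: opp_in_darts boundary_step_def)
  moreover have "orbit (boundary_step F) d \<notin> orbit (boundary_step F) ` (darts F - {d, opp F d})"
    if "boundary_step F d = opp F d"
  proof -
    have "orbit (boundary_step F) d = {d, opp F d}"
      using that boundary_step_opp_pendant_dart by (rule orbit_doubleton)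
    then show ?thesis using self_in_orbit_boundary_step by auto
  qed
  moreover have "orbit (boundary_step F) d \<in> orbit (boundary_step F) ` (darts F - {d, opp F d})"
    if "boundary_step F d \<noteq> opp F d"
  proof (rule image_eqI)
    show "orbit (boundary_step F) d = orbit (boundary_step F) (boundary_step F d)"
      using self_in_orbit_boundary_step[OF pendant_dart_in_darts]
      by (rule self_in_orbit_step[symmetric])
    have "boundary_step F d \<noteq> boundary_step F (opp F d)"
      using bij_betw_boundary_step pendant_dart_in_darts opp_in_darts opp_neq[of d]
      by (auto simp: bij_betw_def inj_on_eq_iff)
    then show "boundary_step F d \<in> darts F - {d, opp F d}"
      using that bij_betw_boundary_step pendant_dart_in_darts
      by (auto simp: boundary_step_opp_pendant_dart bij_betw_def)
  qed
  ultimately show ?thesis by blast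
qed

lemma card_boundary_walks_remove_pendant_edge:
  "card (boundary_walks F) =
    card (boundary_walks (remove_edge F d)) + of_bool (darts_at F (vert F (opp F d)) = {opp F d})"
  using finite_darts orbit_pendant_dart_in_iff
  by (simp add: boundary_walks_pendant_edge card_boundary_walks_remove_pendant_edge_eq_card_orbits
      card_insert_if)

lemma isolated_verts_remove_pendant_edge:
  "isolated_verts (remove_edge F d) = insert (vert F d)
    (isolated_verts F \<union> {v. v = vert F (opp F d) \<and> darts_at F v = {opp F d}})"
proof -
  have "darts_at (remove_edge F d) v = darts_at F v - {d, opp F d}" for v
    by (auto simp: darts_at_def darts_remove_edge[OF pendant_dart_in_darts])
  moreover have "darts_at F v - {d, opp F d} = {} \<longleftrightarrow>
      v = vert F d \<or> darts_at F v = {} \<or> v = vert F (opp F d) \<and> darts_at F v = {opp F d}" for v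
  proof (cases "v = vert F d")
    case False
    then have "darts_at F v - {d, opp F d} = {} \<longleftrightarrow> darts_at F v \<subseteq> {opp F d}"
      by (auto simp: darts_at_def)
    moreover have "v = vert F (opp F d)" if "opp F d \<in> darts_at F v"
      using that by (simp add: darts_at_def)
    ultimately show ?thesis using False by (auto simp: subset_singleton_iff)
  qed (simp add: darts_at_pendant_dart)
  moreover have "vert F d \<in> verts F" "vert F (opp F d) \<in> verts F"
    using pendant_dart_in_darts by (simp_all add: vert_in_verts opp_in_darts)
  ultimately show ?thesis
    by (auto simp: isolated_verts_def)
qed

lemma num_p_remove_pendant_edge: "num_p (remove_edge F d) = num_p F + 1"
proof -
  let ?W = "{v. v = vert F (opp F d) \<and> darts_at F v = {opp F d}}"
  have "finite (isolated_verts F)"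
    by (simp add: isolated_verts_def finite_verts)
  moreover have "vert F d \<notin> isolated_verts F \<union> ?W" "isolated_verts F \<inter> ?W = {}"
    using darts_at_pendant_dart opp_neq[OF pendant_dart_in_darts] by (auto simp: isolated_verts_def)
  ultimately have
    "card (isolated_verts (remove_edge F d)) =
      card (isolated_verts F) + card ?W + 1"
    unfolding isolated_verts_remove_pendant_edge by (simp add: card_Un_disjoint)
  then show ?thesis
    using card_boundary_walks_remove_pendant_edge
    by (cases "darts_at F (vert F (opp F d)) = {opp F d}")
      (auto simp: num_p_def Collect_conv_if cong: conj_cong)
qed

end

lemma
  assumes A: "A \<subseteq> edges F" and d: "pendant_dart (spanning_sub F A) d"
  shows num_k_spanning_sub_remove_pendant_edge:
      "num_k (spanning_sub F (A - {{d, opp F d}})) = num_k (spanning_sub F A) + 1"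
    and num_p_spanning_sub_remove_pendant_edge:
      "num_p (spanning_sub F (A - {{d, opp F d}})) = num_p (spanning_sub F A) + 1"
proof -
  interpret A: ribbon_graph "spanning_sub F A"
    using A by (rule ribbon_graph_spanning_sub)
  show "num_k (spanning_sub F (A - {{d, opp F d}})) = num_k (spanning_sub F A) + 1"
    using A.num_k_remove_pendant_edge[OF d]
    by (simp add: remove_edge_def edges_spanning_sub[OF A] num_k_spanning_sub_spanning_sub)
  show "num_p (spanning_sub F (A - {{d, opp F d}})) = num_p (spanning_sub F A) + 1"
    using A.num_p_remove_pendant_edge[OF d] A
    by (simp add: remove_edge_def edges_spanning_sub num_p_spanning_sub_spanning_sub)
qed

lemma num_k_add_isolated_verts:
  assumes "finite W" and "verts F \<subseteq> W"
  shows "num_k (F\<lparr>verts := W\<rparr>) = num_k F + int (card (W - verts F))"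
proof -
  have "(adjacency F)\<^sup>* `` {v} = {v}" if "v \<notin> verts F" for v
    using that adjacency_subset by (intro rtrancl_Image_not_Domain) blast
  then have "(\<lambda>v. (adjacency F)\<^sup>* `` {v}) ` (W - verts F) = (\<lambda>v. {v}) ` (W - verts F)"
    by (intro image_cong) auto
  moreover have "components (F\<lparr>verts := W\<rparr>) =
      (\<lambda>v. (adjacency F)\<^sup>* `` {v}) ` (verts F \<union> (W - verts F))"
    using assms(2) by (simp add: components_def adjacency_def quotient_eq_image Un_absorb1)
  ultimately have "components (F\<lparr>verts := W\<rparr>) = components F \<union> (\<lambda>v. {v}) ` (W - verts F)"
    by (simp only: image_Un components_eq_image)
  moreover have "components F \<inter> (\<lambda>v. {v}) ` (W - verts F) = {}"
  proof -
    have "u \<in> (adjacency F)\<^sup>* `` {u}" for u by simp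
    then have "(adjacency F)\<^sup>* `` {u} \<noteq> {v}" if "u \<in> verts F" "v \<notin> verts F" for u v
      using that by (metis singletonD)
    then show ?thesis by (auto simp: components_eq_image)
  qed
  ultimately show ?thesis
    using assms(1) by (simp add: num_k_def card_Un_disjoint finite_components card_image)
qed

lemma num_p_add_isolated_verts:
  assumes "finite W" and "verts F \<subseteq> W"
  shows "num_p (F\<lparr>verts := W\<rparr>) = num_p F + int (card (W - verts F))"
proof -
  have "isolated_verts (F\<lparr>verts := W\<rparr>) = isolated_verts F \<union> (W - verts F)"
    using assms(2) vert_in_verts by (auto simp: isolated_verts_def darts_at_def)
  moreover have "isolated_verts F \<inter> (W - verts F) = {}"
    by (auto simp: isolated_verts_def)
  moreover have "finite (isolated_verts F)"
    by (simp add: isolated_verts_def finite_verts)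
  ultimately show ?thesis
    using assms(1) by (simp add: num_p_def boundary_walks_def card_Un_disjoint)
qed

end

subsection \<open>The polynomial as a sum over edge sets\<close>

definition BR_weight ::
    "int \<Rightarrow> 'a::field \<Rightarrow> 'a \<Rightarrow> 'a \<Rightarrow> ('v, 'd) pre_ribbon_graph \<Rightarrow> 'a" where
  "BR_weight r a b c H =
    a powi (r - rk H) * b powi nul H * c powi (num_k H - num_p H + nul H)"

context ribbon_graph
begin

lemma BR_poly_eq_sum_BR_weight:
  "BR_poly F a b c = (\<Sum>A\<in>Pow (edges F). BR_weight (rk F) a b c (spanning_sub F A))"
proof -
  have "states F = spanning_sub F ` Pow (edges F)"
    by (auto simp: states_def)
  moreover have "inj_on (spanning_sub F) (Pow (edges F))"
    by (rule inj_on_inverseI[of _ edges]) (simp add: edges_spanning_sub)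
  ultimately show ?thesis
    by (simp add: BR_poly_def BR_weight_def sum.reindex)
qed

lemma BR_weight_rescale:
  fixes a b c t :: "'a::field"
  assumes "A \<subseteq> edges F" and "t \<noteq> 0"
  shows "t ^ card (edges F - A) * BR_weight (rk F) a b c (spanning_sub F A) =
    t powi nul F * BR_weight (rk F) (a * t) (b / t) c (spanning_sub F A)"
proof -
  let ?H = "spanning_sub F A"
  have "int (card (edges F - A)) = nul F + (rk F - rk ?H) - nul ?H"
    using assms(1) by (simp add: card_edges_Diff nul_def num_e_spanning_sub)
  then have "t ^ card (edges F - A) = t powi nul F * t powi (rk F - rk ?H) / t powi nul ?H"
    using assms(2) by (simp add: power_int_add power_int_diff flip: power_int_of_nat)
  then show ?thesis
    by (simp add: BR_weight_def power_int_mult_distrib power_int_divide_distrib)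
qed

end

subsection \<open>Subdividing every edge\<close>

locale subdivision = ribbon_graph F
  for F :: "('v, 'd) pre_ribbon_graph" +
  fixes p :: nat
  assumes two_le_p: "2 \<le> p"
begin

abbreviation subdiv :: "('v + ('d \<times> nat) set, 'd \<times> nat) pre_ribbon_graph" where
  "subdiv \<equiv> tensor_cycle F p"

lemma verts_subdiv:
  "verts subdiv = Inl ` verts F \<union> Inr ` path_vert F p ` (darts F \<times> {1..<p - 1})"
  by (simp add: tensor_cycle_def)

lemma verts_subdivE:
  assumes "y \<in> verts subdiv"
  obtains (old) v where "v \<in> verts F" "y = Inl v"
  | (new) d i where "d \<in> darts F" "0 < i" "i < p - 1" "y = Inr (path_vert F p (d, i))"
  using assms unfolding verts_subdiv by (elim UnE imageE SigmaE; simp add: Suc_le_eq; blast)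

lemma subdiv_simps [simp]:
  "darts subdiv = darts F \<times> {..<p - 1}"
  "opp subdiv (d, i) = (opp F d, p - 2 - i)"
  "vert subdiv (d, 0) = Inl (vert F d)"
  "0 < i \<Longrightarrow> vert subdiv (d, i) = Inr (path_vert F p (d, i))"
  "rot subdiv (d, 0) = (rot F d, 0)"
  "0 < i \<Longrightarrow> rot subdiv (d, i) = (opp F d, p - 1 - i)"
  by (simp_all add: tensor_cycle_def)

lemma path_vert_opp:
  assumes "d \<in> darts F" and "i \<le> p - 1"
  shows "path_vert F p (opp F d, p - 1 - i) = path_vert F p (d, i)"
  using assms by (auto simp: path_vert_def opp_opp)

lemma darts_at_subdiv_old: "darts_at subdiv (Inl v) = darts_at F v \<times> {0}"
proof -
  have "vert subdiv (d, i) = Inl v \<longleftrightarrow> vert F d = v \<and> i = 0" for d i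
    by (cases "i = 0") simp_all
  then show ?thesis using two_le_p by (auto simp: darts_at_def)
qed

lemma darts_at_subdiv_new:
  assumes "d \<in> darts F" and "0 < i" and "i < p - 1"
  shows "darts_at subdiv (Inr (path_vert F p (d, i))) = {(d, i), (opp F d, p - 1 - i)}"
proof
  have "(d', j) \<in> path_vert F p (d, i)"
    if "vert subdiv (d', j) = Inr (path_vert F p (d, i))" for d' j
    using that by (cases "j = 0") (auto simp: path_vert_def)
  then show "darts_at subdiv (Inr (path_vert F p (d, i))) \<subseteq> {(d, i), (opp F d, p - 1 - i)}"
    by (auto simp: darts_at_def path_vert_def)
  show "{(d, i), (opp F d, p - 1 - i)} \<subseteq> darts_at subdiv (Inr (path_vert F p (d, i)))"
    using assms path_vert_opp[of d i] by (auto simp: darts_at_def opp_in_darts)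
qed

lemma ribbon_graph_subdiv: "ribbon_graph subdiv"
proof
  show "finite (verts subdiv)" "finite (darts subdiv)"
    by (simp_all add: verts_subdiv finite_verts finite_darts)
next
  fix x assume "x \<in> darts subdiv"
  then obtain d i where x: "x = (d, i)" "d \<in> darts F" "i < p - 1" by auto
  then show "opp subdiv x \<in> darts subdiv" "opp subdiv x \<noteq> x" "opp subdiv (opp subdiv x) = x"
    by (auto simp: opp_in_darts opp_neq opp_opp)
  show "vert subdiv x \<in> verts subdiv"
    using x by (cases "i = 0") (auto simp: verts_subdiv vert_in_verts)
next
  fix y assume "y \<in> verts subdiv" and nonempty: "darts_at subdiv y \<noteq> {}"
  from this(1) show "cyclic_on (rot subdiv) (darts_at subdiv y)"
  proof (cases rule: verts_subdivE)
    case (old v)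
    then have "cyclic_on (rot F) (darts_at F v)"
      using nonempty by (intro rot_cyclic) (auto simp: darts_at_subdiv_old)
    then have "cyclic_on (rot subdiv) ((\<lambda>d. (d, 0)) ` darts_at F v)"
      by (rule cyclic_on_image) simp
    also have "(\<lambda>d. (d, 0)) ` darts_at F v = darts_at subdiv y"
      using old by (auto simp: darts_at_subdiv_old)
    finally show ?thesis .
  next
    case (new d i)
    have "orbit (rot subdiv) (d, i) = {(d, i), (opp F d, p - 1 - i)}"
      using new by (intro orbit_doubleton) (simp_all add: opp_opp)
    then show ?thesis
      using new by (intro cyclic_on_singleI[of "(d, i)"]) (simp_all add: darts_at_subdiv_new)
  qed
qed

sublocale subdiv: ribbon_graph subdiv
  by (rule ribbon_graph_subdiv)

lemma num_v_subdiv: "num_v subdiv = num_v F + int (p - 2) * num_e F"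
proof -
  let ?X = "darts F \<times> {1..<p - 1}"
  have "2 * card ((\<lambda>x. {x, (\<lambda>(d, i). (opp F d, p - 1 - i)) x}) ` ?X) = card ?X"
    by (rule card_involution_pairs) (auto simp: finite_darts opp_in_darts opp_opp opp_neq)
  also have "(\<lambda>x. {x, (\<lambda>(d, i). (opp F d, p - 1 - i)) x}) = path_vert F p"
    by (auto simp: path_vert_def)
  also have "card ?X = 2 * card (edges F) * (p - 2)"
    using card_Union_edges[of "edges F"]
    by (simp add: Union_edges card_cartesian_product numeral_2_eq_2)
  finally have "card (path_vert F p ` ?X) = card (edges F) * (p - 2)" by simp
  moreover have "card (verts subdiv) = card (verts F) + card (path_vert F p ` ?X)"
    unfolding verts_subdiv
    by (subst card_Un_disjoint) (auto simp: finite_verts finite_darts card_image)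
  ultimately show ?thesis by (simp add: num_v_def num_e_def)
qed

lemma vert_opp_subdiv:
  assumes "d \<in> darts F" and "Suc i < p - 1"
  shows "vert subdiv (opp subdiv (d, i)) = vert subdiv (d, Suc i)"
  using assms path_vert_opp[of d "Suc i"] by (simp add: numeral_2_eq_2 Suc_diff_Suc)

lemma path_vert_connected:
  assumes "d \<in> darts F" and "i < p - 1"
  shows "(Inl (vert F d), vert subdiv (d, i)) \<in> (adjacency subdiv)\<^sup>*"
  using assms(2)
proof (induction i)
  case (Suc i)
  have "(vert subdiv (d, i), vert subdiv (d, Suc i)) \<in> adjacency subdiv"
    using subdiv.adjacency_dart[of "(d, i)"] vert_opp_subdiv[of d i] assms(1) Suc.prems by simp
  with Suc show ?case by (simp add: rtrancl_into_rtrancl)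
qed simp

lemma adjacent_connected_in_subdiv:
  assumes "(v, w) \<in> adjacency F"
  shows "(Inl v, Inl w) \<in> (adjacency subdiv)\<^sup>*"
proof -
  obtain d where d: "d \<in> darts F" "v = vert F d" "w = vert F (opp F d)"
    using assms by (auto simp: adjacency_def)
  have "(Inl v, vert subdiv (d, p - 2)) \<in> (adjacency subdiv)\<^sup>*"
    using path_vert_connected[of d "p - 2"] d two_le_p by simp
  moreover have "(vert subdiv (d, p - 2), Inl w) \<in> adjacency subdiv"
    using subdiv.adjacency_dart[of "(d, p - 2)"] d two_le_p by simp
  ultimately show ?thesis by (rule rtrancl_into_rtrancl)
qed

text \<open>
  Each of the two half-edges at a new vertex names an end of its path; which one is chosen does not
  matter, since the two ends are adjacent in \<open>F\<close>.
\<close>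

definition path_end :: "'v + ('d \<times> nat) set \<Rightarrow> 'v" where
  "path_end x = (case x of Inl v \<Rightarrow> v | Inr y \<Rightarrow> vert F (fst (SOME z. z \<in> y)))"

lemma path_end_Inl [simp]: "path_end (Inl v) = v"
  by (simp add: path_end_def)

lemma path_end_vert:
  assumes "d \<in> darts F"
  shows "path_end (vert subdiv (d, i)) \<in> {vert F d, vert F (opp F d)}"
proof (cases "i = 0")
  case False
  have "(SOME z. z \<in> path_vert F p (d, i)) \<in> path_vert F p (d, i)"
    by (rule someI[of _ "(d, i)"]) (simp add: path_vert_def)
  then show ?thesis
    using False by (auto simp: path_end_def path_vert_def)
qed simp

lemma path_end_connected:
  assumes "d \<in> darts F"
  shows "(vert F d, path_end (vert subdiv (d, i))) \<in> (adjacency F)\<^sup>*"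
  using path_end_vert[OF assms, of i] adjacency_dart[OF assms] by auto

lemma connected_path_end:
  assumes "x \<in> verts subdiv"
  shows "(x, Inl (path_end x)) \<in> (adjacency subdiv)\<^sup>*"
  using assms
proof (cases rule: verts_subdivE)
  case (new d i)
  then have x: "x = vert subdiv (d, i)" by simp
  have "(x, Inl (vert F d)) \<in> (adjacency subdiv)\<^sup>*"
    unfolding x using path_vert_connected[OF new(1,3)] by (rule subdiv.connected_sym)
  moreover have "(Inl (vert F d), Inl (path_end x)) \<in> (adjacency subdiv)\<^sup>*"
    using path_end_vert[OF new(1), of i] adjacent_connected_in_subdiv[OF adjacency_dart[OF new(1)]]
    by (auto simp: x)
  ultimately show ?thesis by (rule rtrancl_trans)
qed simp

lemma num_k_subdiv: "num_k subdiv = num_k F"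
proof -
  have "card (components F) = card (components subdiv)"
    unfolding components_def
  proof (rule card_quotient_rtrancl_eq[OF sym_adjacency subdiv.sym_adjacency])
    show "Inl \<in> verts F \<rightarrow> verts subdiv" by (auto simp: verts_subdiv)
    show "path_end \<in> verts subdiv \<rightarrow> verts F"
    proof
      fix x assume "x \<in> verts subdiv"
      then show "path_end x \<in> verts F"
      proof (cases rule: verts_subdivE)
        case (new d i)
        then show ?thesis
          using path_end_vert[OF new(1), of i] by (auto simp: vert_in_verts opp_in_darts)
      qed simp
    qed
    show "(path_end x, path_end y) \<in> (adjacency F)\<^sup>*" if xy: "(x, y) \<in> adjacency subdiv" for x y
    proof -
      obtain d i where d: "d \<in> darts F" "x = vert subdiv (d, i)"
        "y = vert subdiv (opp F d, p - 2 - i)"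
        using xy by (auto simp: adjacency_def)
      have "(path_end x, vert F d) \<in> (adjacency F)\<^sup>*"
        unfolding d(2) using path_end_connected[OF d(1)] by (rule connected_sym)
      moreover have "(vert F d, vert F (opp F d)) \<in> (adjacency F)\<^sup>*"
        using adjacency_dart[OF d(1)] by blast
      moreover have "(vert F (opp F d), path_end y) \<in> (adjacency F)\<^sup>*"
        unfolding d(3) by (rule path_end_connected[OF opp_in_darts[OF d(1)]])
      ultimately show ?thesis by (meson rtrancl_trans)
    qed
  qed (simp_all add: adjacent_connected_in_subdiv connected_path_end)
  then show ?thesis by (simp add: num_k_def)
qed

lemma rk_subdiv: "rk subdiv = rk F + int (p - 2) * num_e F"
  by (simp add: rk_def num_v_subdiv num_k_subdiv)

lemma boundary_step_subdiv:
  assumes "d \<in> darts F" and "i < p - 1"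
  shows "boundary_step subdiv (d, i) =
    (if Suc i < p - 1 then (d, Suc i) else (boundary_step F d, 0))"
proof (cases "Suc i < p - 1")
  case True
  then have "0 < p - 2 - i" "p - 1 - (p - 2 - i) = Suc i" by auto
  then show ?thesis using True assms by (simp add: boundary_step_def opp_opp)
next
  case False
  then have "p - 2 - i = 0" by auto
  then show ?thesis using False by (simp add: boundary_step_def)
qed

lemma first_hit_boundary_step_subdiv:
  assumes "d \<in> darts F" and "i < p - 1"
  shows "first_hit (boundary_step subdiv) (darts F \<times> {0}) (d, i) (boundary_step F d, 0)"
  using assms(2)
proof (induction "p - 2 - i" arbitrary: i)
  case 0
  then have "boundary_step subdiv (d, i) = (boundary_step F d, 0)"
    using assms(1) by (subst boundary_step_subdiv) auto
  moreover have "boundary_step F d \<in> darts F"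
    using assms(1) bij_betw_boundary_step by (auto simp: bij_betw_def)
  ultimately show ?case
    using first_hit.now[of "boundary_step subdiv" "(d, i)"] by simp
next
  case (Suc n)
  then have "boundary_step subdiv (d, i) = (d, Suc i)"
    using assms(1) by (subst boundary_step_subdiv) auto
  moreover have "first_hit (boundary_step subdiv) (darts F \<times> {0}) (d, Suc i) (boundary_step F d, 0)"
    using Suc.hyps(2) Suc.prems by (intro Suc.hyps(1)) auto
  ultimately show ?case
    using first_hit.later[of "boundary_step subdiv" "(d, i)"] by simp
qed

lemma boundary_walks_subdiv:
  "boundary_walks subdiv = orbit (boundary_step subdiv) ` (\<lambda>d. (d, 0)) ` darts F"
proof -
  have "orbit (boundary_step subdiv) x \<in> orbit (boundary_step subdiv) ` (\<lambda>d. (d, 0)) ` darts F"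
    if x: "x \<in> darts subdiv" for x
  proof -
    obtain d i where "x = (d, i)" "d \<in> darts F" "i < p - 1"
      using x by auto
    then have "(boundary_step F d, 0) \<in> orbit (boundary_step subdiv) x \<inter> darts F \<times> {0}"
      using first_hit_boundary_step_subdiv first_hit_in_orbit by metis
    moreover have "x \<in> orbit (boundary_step subdiv) x"
      using x by (rule subdiv.self_in_orbit_boundary_step)
    ultimately show ?thesis
      using orbit_eq_if_in_orbit[of x "boundary_step subdiv" "(boundary_step F d, 0)"]
      by (metis IntE SigmaD1 image_eqI)
  qed
  moreover have "(\<lambda>d. (d, 0)) ` darts F \<subseteq> darts subdiv" using two_le_p by auto
  ultimately show ?thesis
    unfolding boundary_walks_eq by (intro subset_antisym image_subsetI) (blast+)
qed

lemma orbit_induced_rot_boundary_step_subdiv: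
  assumes "d \<in> darts F"
  shows "orbit (induced_rot (boundary_step subdiv) ((\<lambda>d. (d, 0)) ` darts F)) (d, 0) =
    (\<lambda>d. (d, 0)) ` orbit (boundary_step F) d"
proof (rule orbit_inverse[symmetric])
  show "d \<in> orbit (boundary_step F) d"
    using assms by (rule self_in_orbit_boundary_step)
  have image_eq: "(\<lambda>d. (d, 0::nat)) ` darts F = darts F \<times> {0}" by auto
  fix x assume "x \<in> orbit (boundary_step F) d"
  then have "x \<in> darts F"
    using orbit_subset_carrier[OF finite_darts bij_betw_boundary_step assms] by blast
  then show "induced_rot (boundary_step subdiv) ((\<lambda>d. (d, 0)) ` darts F) (x, 0) =
      (boundary_step F x, 0)"
    unfolding image_eq using two_le_p
    by (intro induced_rot_eq_if_first_hit first_hit_boundary_step_subdiv) auto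
qed

lemma card_boundary_walks_subdiv: "card (boundary_walks subdiv) = card (boundary_walks F)"
proof -
  let ?B = "(\<lambda>d. (d, 0::nat)) ` darts F"
  have "?B \<subseteq> darts subdiv" using two_le_p by auto
  then have "card (boundary_walks subdiv) =
      card (orbit (induced_rot (boundary_step subdiv) ?B) ` ?B)"
    using card_orbits_induced_rot[OF subdiv.finite_darts subdiv.bij_betw_boundary_step]
    by (simp only: boundary_walks_subdiv)
  also have "orbit (induced_rot (boundary_step subdiv) ?B) ` ?B =
      image (\<lambda>d. (d, 0)) ` boundary_walks F"
    by (simp add: boundary_walks_eq image_image orbit_induced_rot_boundary_step_subdiv
        cong: image_cong)
  also have "card \<dots> = card (boundary_walks F)"
    by (intro card_image inj_on_image) (auto simp: inj_on_def)
  finally show ?thesis .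
qed

lemma isolated_verts_subdiv: "isolated_verts subdiv = Inl ` isolated_verts F"
  by (auto simp: isolated_verts_def verts_subdiv darts_at_subdiv_old darts_at_subdiv_new)

lemma num_p_subdiv: "num_p subdiv = num_p F"
  by (simp add: num_p_def card_boundary_walks_subdiv isolated_verts_subdiv card_image)

subsection \<open>States of the subdivided graph\<close>

definition path_edges :: "'d set \<Rightarrow> ('d \<times> nat) set set" where
  "path_edges e = {f \<in> edges subdiv. f \<subseteq> e \<times> UNIV}"

definition full_paths :: "'d set set \<Rightarrow> ('d \<times> nat) set set" where
  "full_paths K = \<Union>(path_edges ` K)"

definition full_edges :: "('d \<times> nat) set set \<Rightarrow> 'd set set" where
  "full_edges A = {e \<in> edges F. path_edges e \<subseteq> A}"

definition full_part :: "('d \<times> nat) set set \<Rightarrow> ('d \<times> nat) set set" where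
  "full_part A = full_paths (full_edges A)"

lemma path_edges_subset: "path_edges e \<subseteq> edges subdiv"
  by (auto simp: path_edges_def)

lemma finite_path_edges: "finite (path_edges e)"
  using path_edges_subset subdiv.finite_edges by (rule finite_subset)

lemma mem_path_edges_iff:
  assumes "e \<in> edges F" and "f \<in> edges subdiv" and "(d, i) \<in> f"
  shows "f \<in> path_edges e \<longleftrightarrow> d \<in> e"
proof -
  have "f = {(d, i), (opp F d, p - 2 - i)}"
    using subdiv.edge_eq[OF assms(2,3)] by simp
  moreover have "opp F d \<in> e" if "d \<in> e"
    using edge_eq[OF assms(1) that] by blast
  ultimately show ?thesis using assms(2) by (auto simp: path_edges_def)
qed

lemma path_edges_unique:
  assumes "e \<in> edges F" "e' \<in> edges F" "f \<in> path_edges e" "f \<in> path_edges e'"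
  shows "e = e'"
proof -
  have f: "f \<in> edges subdiv" using assms(3) by (simp add: path_edges_def)
  then obtain d i where "(d, i) \<in> f" by (auto simp: edges_def)
  then have "d \<in> e" "d \<in> e'" using assms f mem_path_edges_iff by blast+
  with assms(1,2) show ?thesis by (rule edge_unique)
qed

lemma Union_path_edges:
  assumes "e \<in> edges F"
  shows "\<Union>(path_edges e) = e \<times> {..<p - 1}"
proof
  show "\<Union>(path_edges e) \<subseteq> e \<times> {..<p - 1}"
    using subdiv.Union_edges by (fastforce simp: path_edges_def)
  show "e \<times> {..<p - 1} \<subseteq> \<Union>(path_edges e)"
  proof clarify
    fix d i assume d: "d \<in> e" and "i < p - 1"
    then have "(d, i) \<in> darts subdiv" using assms Union_edges by auto
    then have "{(d, i), opp subdiv (d, i)} \<in> edges subdiv" by (rule subdiv.edge_of_dart)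
    then show "(d, i) \<in> \<Union>(path_edges e)"
      using d mem_path_edges_iff[OF assms] by blast
  qed
qed

lemma edges_subdiv: "edges subdiv = full_paths (edges F)"
proof
  show "edges subdiv \<subseteq> full_paths (edges F)"
  proof
    fix f assume f: "f \<in> edges subdiv"
    then obtain d i where d: "(d, i) \<in> f" "d \<in> darts F" by (auto simp: edges_def)
    then have "f \<in> path_edges {d, opp F d}"
      using mem_path_edges_iff[OF edge_of_dart f] by blast
    then show "f \<in> full_paths (edges F)"
      using edge_of_dart[OF d(2)] by (auto simp: full_paths_def)
  qed
qed (use path_edges_subset in \<open>auto simp: full_paths_def\<close>)

lemma card_path_edges:
  assumes "e \<in> edges F"
  shows "card (path_edges e) = p - 1"
proof -
  have "2 * card (path_edges e) = card e * (p - 1)"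
    using subdiv.card_Union_edges[OF path_edges_subset] assms
    by (simp add: Union_path_edges card_cartesian_product)
  moreover have "card e = 2"
    using card_Union_edges[of "{e}"] assms by simp
  ultimately show ?thesis by simp
qed

lemma card_Int_full_paths:
  assumes "K \<subseteq> edges F"
  shows "card (A \<inter> full_paths K) = (\<Sum>e\<in>K. card (A \<inter> path_edges e))"
proof -
  have "card (\<Union>e\<in>K. A \<inter> path_edges e) = (\<Sum>e\<in>K. card (A \<inter> path_edges e))"
  proof (rule card_UN_disjoint)
    show "finite K" using assms finite_edges by (rule finite_subset)
    have "path_edges e \<inter> path_edges e' = {}" if "e \<in> K" "e' \<in> K" "e \<noteq> e'" for e e'
      using that assms path_edges_unique[of e e'] by blast
    then show "\<forall>e\<in>K. \<forall>e'\<in>K. e \<noteq> e' \<longrightarrow> (A \<inter> path_edges e) \<inter> (A \<inter> path_edges e') = {}"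
      by blast
  qed (simp add: finite_path_edges)
  then show ?thesis by (simp only: full_paths_def Int_UN_distrib)
qed

lemma card_full_paths:
  assumes "K \<subseteq> edges F"
  shows "card (full_paths K) = card K * (p - 1)"
proof -
  have "(\<Sum>e\<in>K. card (path_edges e)) = (\<Sum>e\<in>K. p - 1)"
    using assms by (intro sum.cong refl card_path_edges) auto
  then show ?thesis
    using card_Int_full_paths[OF assms, of UNIV] by simp
qed

lemma full_part_subset: "full_part A \<subseteq> A"
  by (auto simp: full_part_def full_paths_def full_edges_def)

lemma full_edges_subset: "full_edges A \<subseteq> edges F"
  by (auto simp: full_edges_def)

lemma mem_full_part_iff:
  assumes "e \<in> edges F" and "f \<in> path_edges e"
  shows "f \<in> full_part A \<longleftrightarrow> e \<in> full_edges A"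
proof
  assume "f \<in> full_part A"
  then obtain e' where "e' \<in> full_edges A" "f \<in> path_edges e'"
    by (auto simp: full_part_def full_paths_def)
  moreover from this have "e = e'"
    using assms full_edges_subset path_edges_unique[of e e' f] by blast
  ultimately show "e \<in> full_edges A" by simp
qed (use assms(2) in \<open>auto simp: full_part_def full_paths_def\<close>)

lemma full_edges_iff:
  assumes "A \<subseteq> edges subdiv" and "e \<in> edges F"
  shows "e \<in> full_edges A \<longleftrightarrow> e \<times> {..<p - 1} \<subseteq> \<Union>A"
proof
  assume "e \<in> full_edges A"
  then show "e \<times> {..<p - 1} \<subseteq> \<Union>A"
    unfolding Union_path_edges[OF assms(2), symmetric] by (auto simp: full_edges_def)
next
  assume darts: "e \<times> {..<p - 1} \<subseteq> \<Union>A"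
  have "f \<in> A" if f: "f \<in> path_edges e" for f
  proof -
    have "f \<in> edges subdiv" using f path_edges_subset by blast
    then obtain x where "x \<in> f" by (auto simp: edges_def)
    then have "x \<in> \<Union>A" using f darts Union_path_edges[OF assms(2)] by blast
    then obtain g where "g \<in> A" "x \<in> g" by blast
    then have "f = g"
      using \<open>f \<in> edges subdiv\<close> \<open>x \<in> f\<close> assms(1) subdiv.edge_unique[of f g x] by blast
    with \<open>g \<in> A\<close> show ?thesis by simp
  qed
  then show "e \<in> full_edges A" using assms(2) by (auto simp: full_edges_def)
qed

lemma full_edges_remove:
  assumes "f \<notin> full_part A"
  shows "full_edges (A - {f}) = full_edges A"
  using assms by (auto simp: full_edges_def full_part_def full_paths_def)

subsection \<open>States consisting of full paths\<close>

text \<open>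
  A state consisting of full paths is the subdivision of a state of \<open>F\<close>, together with the inner
  vertices of the paths that are left out.
\<close>

context
  fixes K :: "'d set set"
  assumes K: "K \<subseteq> edges F"
begin

lemma subdivision_spanning_sub: "subdivision (spanning_sub F K) p"
  using ribbon_graph_spanning_sub[OF K] two_le_p
  by (simp add: subdivision_def subdivision_axioms_def)

interpretation K: subdivision "spanning_sub F K" p
  by (rule subdivision_spanning_sub)

lemma darts_full_paths: "\<Union>(full_paths K) = darts K.subdiv"
proof -
  have "\<Union>(full_paths K) = (\<Union>e\<in>K. \<Union>(path_edges e))"
    by (auto simp: full_paths_def)
  also have "\<dots> = (\<Union>e\<in>K. e \<times> {..<p - 1})"
    using K Union_path_edges by (intro SUP_cong refl) blast
  also have "\<dots> = darts K.subdiv" by auto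
  finally show ?thesis .
qed

lemma path_vert_spanning_sub: "path_vert (spanning_sub F K) p = path_vert F p"
  by (simp add: path_vert_def)

lemma vert_subdiv_spanning_sub: "vert K.subdiv = vert subdiv"
  by (auto simp: tensor_cycle_def path_vert_spanning_sub)

lemma opp_subdiv_spanning_sub: "opp K.subdiv = opp subdiv"
  by (auto simp: tensor_cycle_def)

lemma verts_subdiv_spanning_sub: "verts K.subdiv \<subseteq> verts subdiv"
proof -
  have "\<Union>K \<times> {1..<p - 1} \<subseteq> darts F \<times> {1..<p - 1}" using K Union_edges by blast
  then show ?thesis
    unfolding verts_subdiv K.verts_subdiv path_vert_spanning_sub spanning_sub_simps
    by (intro Un_mono image_mono) simp_all
qed

lemma card_unused_path_verts:
  "int (card (verts subdiv - verts K.subdiv)) = int (p - 2) * (num_e F - int (card K))"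
proof -
  have "card (verts K.subdiv) \<le> card (verts subdiv)"
    using verts_subdiv_spanning_sub by (rule card_mono[OF subdiv.finite_verts])
  then have "int (card (verts subdiv - verts K.subdiv)) = num_v subdiv - num_v K.subdiv"
    using verts_subdiv_spanning_sub K.subdiv.finite_verts
    by (simp add: card_Diff_subset num_v_def of_nat_diff)
  then show ?thesis
    by (simp add: num_v_subdiv K.num_v_subdiv num_e_spanning_sub K algebra_simps)
qed

lemma rot_full_paths:
  assumes "x \<in> darts K.subdiv"
  shows "rot (spanning_sub subdiv (full_paths K)) x = rot K.subdiv x"
proof -
  obtain d i where x: "x = (d, i)" "d \<in> \<Union>K" "i < p - 1" using assms by auto
  have sub: "\<Union>K \<subseteq> darts F" using K Union_edges by blast
  have "induced_rot (rot subdiv) (darts K.subdiv) (d, i) = rot K.subdiv (d, i)"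
  proof (cases "i = 0")
    case True
    have "first_hit (rot F) (\<Union>K) d (induced_rot (rot F) (\<Union>K) d)"
      using finite_darts bij_betw_rot sub x(2) by (rule first_hit_return)
    then have "first_hit (rot subdiv) (darts K.subdiv) (d, 0) (induced_rot (rot F) (\<Union>K) d, 0)"
      by (rule first_hit_semiconj) (use two_le_p in auto)
    then show ?thesis using True by (simp add: induced_rot_eq_if_first_hit)
  next
    case False
    have "opp F d \<in> \<Union>K" using x(2) K edge_eq by blast
    then have "rot subdiv (d, i) \<in> darts K.subdiv" using False x(3) by auto
    then show ?thesis using False by (subst induced_rot_now) simp_all
  qed
  then show ?thesis by (simp add: darts_full_paths x(1) del: K.subdiv_simps)
qed

lemma num_k_full_paths:
  "num_k (spanning_sub subdiv (full_paths K)) =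
    num_k (spanning_sub F K) + int (p - 2) * (num_e F - int (card K))"
proof -
  have "num_k (spanning_sub subdiv (full_paths K)) = num_k (K.subdiv\<lparr>verts := verts subdiv\<rparr>)"
    by (simp add: num_k_def components_def adjacency_def darts_full_paths
        vert_subdiv_spanning_sub opp_subdiv_spanning_sub del: K.subdiv_simps subdiv_simps)
  also have "\<dots> = num_k K.subdiv + int (card (verts subdiv - verts K.subdiv))"
    using subdiv.finite_verts verts_subdiv_spanning_sub by (rule K.subdiv.num_k_add_isolated_verts)
  finally show ?thesis by (simp only: K.num_k_subdiv card_unused_path_verts)
qed

lemma num_p_full_paths:
  "num_p (spanning_sub subdiv (full_paths K)) =
    num_p (spanning_sub F K) + int (p - 2) * (num_e F - int (card K))"
proof -
  have "boundary_walks (spanning_sub subdiv (full_paths K)) = boundary_walks K.subdiv"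
    by (rule K.subdiv.boundary_walks_cong[OF _ _ rot_full_paths])
      (simp_all only: spanning_sub_simps darts_full_paths opp_subdiv_spanning_sub)
  then have "num_p (spanning_sub subdiv (full_paths K)) =
      num_p (K.subdiv\<lparr>verts := verts subdiv\<rparr>)"
    by (simp add: num_p_def isolated_verts_def darts_at_def boundary_walks_def darts_full_paths
        vert_subdiv_spanning_sub del: K.subdiv_simps subdiv_simps)
  also have "\<dots> = num_p K.subdiv + int (card (verts subdiv - verts K.subdiv))"
    using subdiv.finite_verts verts_subdiv_spanning_sub by (rule K.subdiv.num_p_add_isolated_verts)
  finally show ?thesis by (simp only: K.num_p_subdiv card_unused_path_verts)
qed

end

subsection \<open>Removing the incomplete paths\<close>

lemma pendant_dart_at_gap:
  assumes A: "A \<subseteq> edges subdiv" and d: "d \<in> darts F" and i: "Suc i < p - 1"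
    and kept: "(d, i) \<in> \<Union>A" and gap: "(d, Suc i) \<notin> \<Union>A"
  defines "x \<equiv> opp subdiv (d, i)"
  shows "pendant_dart (spanning_sub subdiv A) x" and "{x, opp subdiv x} \<in> A - full_part A"
proof -
  have di: "(d, i) \<in> darts subdiv" using d i by simp
  obtain f where f: "f \<in> A" "(d, i) \<in> f" using kept by blast
  then have f_eq: "f = {x, opp subdiv x}"
    using A subdiv.edge_eq[of f "(d, i)"] subdiv.opp_opp[OF di] by (auto simp: x_def)
  have e: "{d, opp F d} \<in> edges F" using d by (rule edge_of_dart)
  have "f \<in> path_edges {d, opp F d}"
    using f A mem_path_edges_iff[OF e] by blast
  moreover have "{d, opp F d} \<notin> full_edges A"
    using gap i full_edges_iff[OF A e] by blast
  ultimately have "f \<notin> full_part A"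
    using mem_full_part_iff[OF e] by blast
  with f(1) show "{x, opp subdiv x} \<in> A - full_part A" by (simp add: f_eq)
  have x: "x \<in> \<Union>A" using f(1) f_eq by blast
  moreover have "x = (opp F d, p - 1 - Suc i)" by (simp add: x_def numeral_2_eq_2)
  moreover have "darts_at subdiv (vert subdiv x) = {(d, Suc i), (opp F d, p - 1 - Suc i)}"
    using vert_opp_subdiv[OF d i] darts_at_subdiv_new[OF d _ i] by (simp add: x_def)
  ultimately have "darts_at (spanning_sub subdiv A) (vert subdiv x) = {x}"
    using gap by (auto simp: subdiv.darts_at_spanning_sub[OF A])
  with x show "pendant_dart (spanning_sub subdiv A) x" by (simp add: pendant_dart_def)
qed

lemma exists_partial_path:
  assumes A: "A \<subseteq> edges subdiv" and "A \<noteq> full_part A"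
  shows "\<exists>d\<in>darts F. \<exists>i<p - 1. \<exists>j<p - 1. (d, i) \<in> \<Union>A \<and> (d, j) \<notin> \<Union>A"
proof -
  obtain f where f: "f \<in> A" "f \<notin> full_part A"
    using assms(2) full_part_subset by blast
  then have "f \<in> edges subdiv" using A by blast
  then obtain d i where di: "(d, i) \<in> f" "d \<in> darts F" "i < p - 1"
    by (auto simp: edges_def)
  let ?e = "{d, opp F d}"
  have e: "?e \<in> edges F" using di(2) by (rule edge_of_dart)
  have "f \<in> path_edges ?e"
    using \<open>f \<in> edges subdiv\<close> di(1) mem_path_edges_iff[OF e] by blast
  then have "?e \<notin> full_edges A"
    using f(2) mem_full_part_iff[OF e] by blast
  then obtain c j where c: "c \<in> ?e" "j < p - 1" "(c, j) \<notin> \<Union>A"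
    using full_edges_iff[OF A e] by blast
  have "\<exists>j<p - 1. (d, j) \<notin> \<Union>A"
  proof (cases "c = d")
    case False
    then have "(d, p - 2 - j) \<notin> \<Union>A"
      using c subdiv.opp_in_Union_iff[OF A, of "(c, j)"] di(2)
      by (auto simp: opp_in_darts opp_opp)
    moreover have "p - 2 - j < p - 1" using two_le_p by simp
    ultimately show ?thesis by blast
  qed (use c in blast)
  then show ?thesis using f(1) di by blast
qed

lemma exists_gap:
  assumes A: "A \<subseteq> edges subdiv" and "A \<noteq> full_part A"
  shows "\<exists>d\<in>darts F. \<exists>i. Suc i < p - 1 \<and> (d, i) \<in> \<Union>A \<and> (d, Suc i) \<notin> \<Union>A"
proof -
  obtain d i j where d: "d \<in> darts F"
    and "i < p - 1" "j < p - 1" "(d, i) \<in> \<Union>A" "(d, j) \<notin> \<Union>A"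
    using exists_partial_path[OF assms] by blast
  then obtain k where k: "Suc k < p - 1" "((d, k) \<in> \<Union>A) \<noteq> ((d, Suc k) \<in> \<Union>A)"
    using exists_consecutive_change[of i "p - 1" j "\<lambda>k. (d, k) \<in> \<Union>A"] by blast
  show ?thesis
  proof (cases "(d, k) \<in> \<Union>A")
    case True
    then show ?thesis using d k by blast
  next
    case False
    have "(opp F d, p - 2 - j) \<in> \<Union>A \<longleftrightarrow> (d, j) \<in> \<Union>A" if "j < p - 1" for j
      using subdiv.opp_in_Union_iff[OF A, of "(d, j)"] that d by simp
    moreover have "Suc (p - 2 - Suc k) = p - 2 - k" "Suc (p - 2 - Suc k) < p - 1"
      using k(1) by simp_all
    ultimately have "(opp F d, p - 2 - Suc k) \<in> \<Union>A" "(opp F d, Suc (p - 2 - Suc k)) \<notin> \<Union>A"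
      using False k by simp_all
    then show ?thesis
      using opp_in_darts[OF d] \<open>Suc (p - 2 - Suc k) < p - 1\<close> by blast
  qed
qed

lemma full_part_eq_if_remove_pendant_edge:
  fixes N :: "('v + ('d \<times> nat) set, 'd \<times> nat) pre_ribbon_graph \<Rightarrow> int"
  assumes N: "\<And>A x. A \<subseteq> edges subdiv \<Longrightarrow> pendant_dart (spanning_sub subdiv A) x \<Longrightarrow>
      N (spanning_sub subdiv (A - {{x, opp subdiv x}})) = N (spanning_sub subdiv A) + 1"
    and "A \<subseteq> edges subdiv"
  shows "N (spanning_sub subdiv (full_part A)) =
    N (spanning_sub subdiv A) + int (card (A - full_part A))"
  using assms(2)
proof (induction A rule: measure_induct_rule[where f = card])
  case (less A)
  have fin: "finite A" using less.prems subdiv.finite_edges by (rule finite_subset)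
  show ?case
  proof (cases "A = full_part A")
    case False
    then obtain d i where gap: "d \<in> darts F" "Suc i < p - 1" "(d, i) \<in> \<Union>A" "(d, Suc i) \<notin> \<Union>A"
      using exists_gap[OF less.prems] by blast
    define x where "x = opp subdiv (d, i)"
    define f where "f = {x, opp subdiv x}"
    have f: "f \<in> A - full_part A"
      unfolding f_def x_def using less.prems gap by (rule pendant_dart_at_gap(2))
    have "pendant_dart (spanning_sub subdiv A) x"
      unfolding x_def using less.prems gap by (rule pendant_dart_at_gap(1))
    with less.prems have "N (spanning_sub subdiv (A - {f})) = N (spanning_sub subdiv A) + 1"
      unfolding f_def by (rule N)
    moreover have "full_part (A - {f}) = full_part A"
      using full_edges_remove[of f A] f by (simp add: full_part_def)
    moreover have "card (A - {f}) < card A"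
      using fin f by (intro psubset_card_mono) auto
    moreover have "A - full_part A = insert f (A - {f} - full_part A)"
      using f by blast
    then have "card (A - full_part A) = Suc (card (A - {f} - full_part A))"
      using fin by (metis DiffE card_insert_disjoint finite_Diff insertI1)
    moreover have "A - {f} \<subseteq> edges subdiv"
      using less.prems by blast
    ultimately show ?thesis
      using less.IH[of "A - {f}"] by simp
  qed simp
qed

lemma num_k_full_part:
  "A \<subseteq> edges subdiv \<Longrightarrow> num_k (spanning_sub subdiv (full_part A)) =
    num_k (spanning_sub subdiv A) + int (card (A - full_part A))"
  by (rule full_part_eq_if_remove_pendant_edge[OF subdiv.num_k_spanning_sub_remove_pendant_edge])

lemma num_p_full_part:
  "A \<subseteq> edges subdiv \<Longrightarrow> num_p (spanning_sub subdiv (full_part A)) =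
    num_p (spanning_sub subdiv A) + int (card (A - full_part A))"
  by (rule full_part_eq_if_remove_pendant_edge[OF subdiv.num_p_spanning_sub_remove_pendant_edge])

text \<open>
  The number of components of a state that contain no vertex of \<open>F\<close>: a path with \<open>j \<ge> 1\<close> missing
  edges falls into \<open>j + 1\<close> pieces, \<open>j - 1\<close> of which avoid both of its ends.
\<close>

definition free_pieces :: "('d \<times> nat) set set \<Rightarrow> nat" where
  "free_pieces A = (\<Sum>e\<in>edges F - full_edges A. p - 2 - card (A \<inter> path_edges e))"

lemma card_Diff_full_part:
  assumes "A \<subseteq> edges subdiv"
  shows "card (A - full_part A) = (\<Sum>e\<in>edges F - full_edges A. card (A \<inter> path_edges e))"
proof -
  have "A - full_part A = A \<inter> full_paths (edges F - full_edges A)"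
    using assms mem_full_part_iff[where A = A] unfolding edges_subdiv full_paths_def by blast
  then show ?thesis by (simp add: card_Int_full_paths)
qed

lemma card_Int_path_edges_less:
  assumes "e \<in> edges F - full_edges A"
  shows "card (A \<inter> path_edges e) < p - 1"
proof -
  have "A \<inter> path_edges e \<subset> path_edges e" using assms by (auto simp: full_edges_def)
  then have "card (A \<inter> path_edges e) < card (path_edges e)"
    using finite_path_edges by (rule psubset_card_mono[rotated])
  then show ?thesis using assms by (simp add: card_path_edges)
qed

lemma free_pieces_eq:
  assumes "A \<subseteq> edges subdiv"
  shows "int (free_pieces A) =
    int (p - 2) * (num_e F - int (card (full_edges A))) - int (card (A - full_part A))"
proof -
  let ?E = "edges F - full_edges A"
  have "int (p - 2 - card (A \<inter> path_edges e)) = int (p - 2) - int (card (A \<inter> path_edges e))"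
    if "e \<in> ?E" for e
    using card_Int_path_edges_less[OF that] by (simp add: of_nat_diff)
  then have "int (free_pieces A) =
      (\<Sum>e\<in>?E. int (p - 2) - int (card (A \<inter> path_edges e)))"
    unfolding free_pieces_def of_nat_sum by (rule sum.cong[OF refl])
  also have "\<dots> = int (card ?E) * int (p - 2) - int (card (A - full_part A))"
    by (simp add: sum_subtractf card_Diff_full_part[OF assms])
  finally show ?thesis by (simp add: card_edges_Diff full_edges_subset mult.commute)
qed

context
  fixes A :: "('d \<times> nat) set set"
  assumes A: "A \<subseteq> edges subdiv"
begin

lemma num_k_spanning_sub_subdiv:
  "num_k (spanning_sub subdiv A) =
    num_k (spanning_sub F (full_edges A)) + int (free_pieces A)"
  using num_k_full_part[OF A] num_k_full_paths[OF full_edges_subset[of A]]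
  by (simp add: free_pieces_eq[OF A] full_part_def)

lemma num_p_spanning_sub_subdiv:
  "num_p (spanning_sub subdiv A) =
    num_p (spanning_sub F (full_edges A)) + int (free_pieces A)"
  using num_p_full_part[OF A] num_p_full_paths[OF full_edges_subset[of A]]
  by (simp add: free_pieces_eq[OF A] full_part_def)

lemma rk_spanning_sub_subdiv:
  "rk subdiv - rk (spanning_sub subdiv A) =
    rk F - rk (spanning_sub F (full_edges A)) + int (free_pieces A)"
  by (simp add: rk_def num_v_subdiv num_k_subdiv num_k_spanning_sub_subdiv)

lemma nul_spanning_sub_subdiv: "nul (spanning_sub subdiv A) = nul (spanning_sub F (full_edges A))"
proof -
  have fin: "finite A" using A subdiv.finite_edges by (rule finite_subset)
  have "card A = card (full_part A) + card (A - full_part A)"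
    using card_Un_disjoint[of "full_part A" "A - full_part A"] fin full_part_subset[of A]
    by (simp add: finite_subset Un_absorb1)
  also have "card (full_part A) = card (full_edges A) * (p - 1)"
    unfolding full_part_def by (rule card_full_paths[OF full_edges_subset])
  also have "p - 1 = Suc (p - 2)" using two_le_p by simp
  finally have "int (card A) =
      int (card (full_edges A)) + int (p - 2) * num_e F - int (free_pieces A)"
    using free_pieces_eq[OF A] by (simp add: int_distrib mult.commute)
  then show ?thesis
    using rk_spanning_sub_subdiv
    by (simp add: nul_def subdiv.num_e_spanning_sub[OF A] num_e_spanning_sub full_edges_subset
        rk_subdiv)
qed

end

subsection \<open>The state sum\<close>

definition merge_paths :: "'d set set \<Rightarrow> ('d set \<Rightarrow> ('d \<times> nat) set set) \<Rightarrow> ('d \<times> nat) set set" where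
  "merge_paths K g = full_paths K \<union> \<Union>(g ` (edges F - K))"

lemma mem_merge_paths_iff:
  assumes "K \<subseteq> edges F" and g: "\<And>e. e \<in> edges F - K \<Longrightarrow> g e \<subseteq> path_edges e"
    and e: "e \<in> edges F" and f: "f \<in> path_edges e"
  shows "f \<in> merge_paths K g \<longleftrightarrow> e \<in> K \<or> f \<in> g e"
proof
  assume "f \<in> merge_paths K g"
  then obtain e' where e': "e' \<in> edges F" "e' \<in> K \<and> f \<in> path_edges e' \<or> e' \<notin> K \<and> f \<in> g e'"
    using assms(1) by (auto simp: merge_paths_def full_paths_def)
  moreover from this have "f \<in> path_edges e'" using g by blast
  then have "e' = e" using e'(1) e f path_edges_unique[of e' e f] by simp
  ultimately show "e \<in> K \<or> f \<in> g e" by blast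
qed (use e f in \<open>auto simp: merge_paths_def full_paths_def\<close>)

lemma full_edges_merge_paths:
  assumes K: "K \<subseteq> edges F" and g: "\<And>e. e \<in> edges F - K \<Longrightarrow> g e \<subset> path_edges e"
  shows "full_edges (merge_paths K g) = K"
proof -
  have "path_edges e \<subseteq> merge_paths K g \<longleftrightarrow> e \<in> K" if e: "e \<in> edges F" for e
  proof -
    have "f \<in> merge_paths K g \<longleftrightarrow> e \<in> K \<or> f \<in> g e" if "f \<in> path_edges e" for f
      using K g e that by (intro mem_merge_paths_iff) auto
    moreover have "e \<in> K \<or> g e \<subset> path_edges e" using g e by blast
    ultimately show ?thesis by blast
  qed
  then show ?thesis using K by (auto simp: full_edges_def)
qed

lemma merge_paths_Int_path_edges:
  assumes "A \<subseteq> edges subdiv"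
  shows "merge_paths (full_edges A) (\<lambda>e. A \<inter> path_edges e) = A"
proof
  show "merge_paths (full_edges A) (\<lambda>e. A \<inter> path_edges e) \<subseteq> A"
    by (auto simp: merge_paths_def full_paths_def full_edges_def)
  show "A \<subseteq> merge_paths (full_edges A) (\<lambda>e. A \<inter> path_edges e)"
  proof
    fix f assume f: "f \<in> A"
    then obtain e where "e \<in> edges F" "f \<in> path_edges e"
      using assms by (auto simp: edges_subdiv full_paths_def)
    with f show "f \<in> merge_paths (full_edges A) (\<lambda>e. A \<inter> path_edges e)"
      unfolding merge_paths_def full_paths_def by (cases "e \<in> full_edges A") blast+
  qed
qed

lemma bij_betw_partial_paths:
  assumes K: "K \<subseteq> edges F"
  shows "bij_betw (\<lambda>A. \<lambda>e\<in>edges F - K. A \<inter> path_edges e)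
    {A \<in> Pow (edges subdiv). full_edges A = K}
    (PiE (edges F - K) (\<lambda>e. Pow (path_edges e) - {path_edges e}))"
    (is "bij_betw ?split ?S ?T")
proof (rule bij_betwI[OF Pi_I Pi_I])
  show "?split A \<in> ?T" if "A \<in> ?S" for A
  proof (intro restrict_PiE_iff[THEN iffD2] ballI)
    fix e assume "e \<in> edges F - K"
    with that have "\<not> path_edges e \<subseteq> A" by (auto simp: full_edges_def)
    then show "A \<inter> path_edges e \<in> Pow (path_edges e) - {path_edges e}" by blast
  qed
  show "merge_paths K (?split A) = A" if "A \<in> ?S" for A
    using that merge_paths_Int_path_edges[of A] by (simp add: merge_paths_def)
  fix g assume g: "g \<in> ?T"
  then have proper: "g e \<subset> path_edges e" if "e \<in> edges F - K" for e
    using that by blast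
  have "merge_paths K g \<subseteq> edges subdiv"
    using proper path_edges_subset unfolding merge_paths_def full_paths_def by blast
  then show "merge_paths K g \<in> ?S"
    using full_edges_merge_paths[OF K proper] by simp
  show "?split (merge_paths K g) = g"
  proof (rule extensionalityI)
    fix e assume e: "e \<in> edges F - K"
    have "f \<in> merge_paths K g \<longleftrightarrow> f \<in> g e" if "f \<in> path_edges e" for f
      using e that mem_merge_paths_iff[OF K psubset_imp_subset[OF proper]] by auto
    then show "?split (merge_paths K g) e = g e"
      using e proper[OF e] by auto
  qed (use g in \<open>auto simp: PiE_def\<close>)
qed

lemma sum_over_full_edges:
  fixes a :: "'a::idom"
  assumes K: "K \<subseteq> edges F" and "a \<noteq> 0"
  shows "(\<Sum>A | A \<in> Pow (edges subdiv) \<and> full_edges A = K. a ^ free_pieces A) =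
    (\<Sum>i<p - 1. (a + 1) ^ i) ^ card (edges F - K)"
proof -
  let ?E = "edges F - K"
  let ?proper = "\<lambda>e. Pow (path_edges e) - {path_edges e}"
  have "(\<Sum>A | A \<in> Pow (edges subdiv) \<and> full_edges A = K. a ^ free_pieces A) =
      (\<Sum>A | A \<in> Pow (edges subdiv) \<and> full_edges A = K.
        \<Prod>e\<in>?E. a ^ (p - 2 - card ((\<lambda>e\<in>?E. A \<inter> path_edges e) e)))"
    by (rule sum.cong) (auto simp: free_pieces_def power_sum)
  also have "\<dots> = (\<Sum>g\<in>PiE ?E ?proper. \<Prod>e\<in>?E. a ^ (p - 2 - card (g e)))"
    by (rule sum.reindex_bij_betw[OF bij_betw_partial_paths[OF K]])
  also have "\<dots> = (\<Prod>e\<in>?E. \<Sum>X\<in>?proper e. a ^ (p - 2 - card X))"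
    by (rule prod_sum_PiE[symmetric]) (simp_all add: finite_edges finite_path_edges)
  also have "\<dots> = (\<Prod>e\<in>?E. \<Sum>i<p - 1. (a + 1) ^ i)"
  proof (rule prod.cong[OF refl])
    fix e assume "e \<in> ?E"
    then have "card (path_edges e) = p - 1" by (simp add: card_path_edges)
    then show "(\<Sum>X\<in>?proper e. a ^ (p - 2 - card X)) = (\<Sum>i<p - 1. (a + 1) ^ i)"
      using sum_power_proper_subsets[OF finite_path_edges \<open>a \<noteq> 0\<close>, of e]
      by (simp add: numeral_2_eq_2)
  qed
  finally show ?thesis by simp
qed

lemma BR_weight_spanning_sub_subdiv:
  assumes "A \<subseteq> edges subdiv" and "a \<noteq> 0"
  shows "BR_weight (rk subdiv) a b c (spanning_sub subdiv A) =
    a ^ free_pieces A * BR_weight (rk F) a b c (spanning_sub F (full_edges A))"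
  using assms
  by (simp add: BR_weight_def power_int_add rk_spanning_sub_subdiv nul_spanning_sub_subdiv
      num_k_spanning_sub_subdiv num_p_spanning_sub_subdiv)

theorem BR_poly_tensor_cycle:
  fixes a b c :: "'a::field"
  defines "t \<equiv> \<Sum>i<p - 1. (a + 1) ^ i"
  assumes "a \<noteq> 0" and "t \<noteq> 0"
  shows "BR_poly (tensor_cycle F p) a b c = t powi nul F * BR_poly F (a * t) (b / t) c"
proof -
  let ?w = "\<lambda>K. BR_weight (rk F) a b c (spanning_sub F K)"
  have "BR_poly subdiv a b c =
      (\<Sum>A\<in>Pow (edges subdiv). a ^ free_pieces A * ?w (full_edges A))"
    unfolding subdiv.BR_poly_eq_sum_BR_weight
    using \<open>a \<noteq> 0\<close> by (intro sum.cong refl BR_weight_spanning_sub_subdiv) auto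
  also have "\<dots> = (\<Sum>K\<in>Pow (edges F). \<Sum>A | A \<in> Pow (edges subdiv) \<and> full_edges A = K.
      a ^ free_pieces A * ?w (full_edges A))"
    using finite_edges subdiv.finite_edges full_edges_subset
    by (intro sum.group[symmetric]) auto
  also have "\<dots> = (\<Sum>K\<in>Pow (edges F).
      (\<Sum>A | A \<in> Pow (edges subdiv) \<and> full_edges A = K. a ^ free_pieces A) * ?w K)"
    by (simp add: sum_distrib_right)
  also have "\<dots> = (\<Sum>K\<in>Pow (edges F). t ^ card (edges F - K) * ?w K)"
    using sum_over_full_edges[OF _ \<open>a \<noteq> 0\<close>]
    by (intro sum.cong refl) (simp only: t_def Pow_iff)
  also have "\<dots> = (\<Sum>K\<in>Pow (edges F).
      t powi nul F * BR_weight (rk F) (a * t) (b / t) c (spanning_sub F K))"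
    using \<open>t \<noteq> 0\<close> by (intro sum.cong refl BR_weight_rescale) auto
  finally show ?thesis
    by (simp add: BR_poly_eq_sum_BR_weight sum_distrib_left)
qed

end

theorem theorem5p2:
  fixes F :: "('v, 'd) pre_ribbon_graph" and \<alpha> \<beta> \<gamma> s :: complex
  assumes "ribbon_graph F"
    and "\<alpha> \<noteq> - 2" and "\<alpha> \<noteq> 0" and "\<alpha> \<noteq> 1"
    and "\<beta> = \<alpha> * (1 - \<alpha>)"
    and "s\<^sup>2 = \<alpha> * \<beta>" and "\<gamma> = 1 / s"
  shows "BR_poly (tensor_cycle F 3) \<alpha> \<beta> \<gamma>
         = (\<alpha> + 2) powi nul F * BR_poly F (\<alpha> * (\<alpha> + 2)) (\<beta> / (\<alpha> + 2)) \<gamma>"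
proof -
  interpret subdivision F 3
    using \<open>ribbon_graph F\<close> by (simp add: subdivision_def subdivision_axioms_def)
  have "(\<Sum>i<3 - 1. (\<alpha> + 1) ^ i) = \<alpha> + 2"
    by (simp add: numeral_2_eq_2)
  moreover have "\<alpha> + 2 \<noteq> 0"
    using \<open>\<alpha> \<noteq> - 2\<close> by (simp add: add_eq_0_iff2)
  ultimately show ?thesis
    using BR_poly_tensor_cycle[of \<alpha> \<beta> \<gamma>] \<open>\<alpha> \<noteq> 0\<close> by simp
qed

end
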